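(* Let $s\in\mathbb{R}_+\setminus\mathbb{N}$. There exists a dense open set (hence a generic set) $\mathcal{R}$ of functions in $C^s(\mathbb{H})$ such that for every $f\in\mathcal{R}$ and every $x\in\mathbb{H}$, $h_f(x)=s$.
   Context: Heisenberg group: $\mathbb{H}=\mathbb{R}^3$ with law $(p,q,r)\ast(p',q',r')=(p+p',q+q',r+r'+2(qp'-pq'))$ (also written $xy$), inverse $x^{-1}=-x$, dilations $\lambda\circ(p,q,r)=(\lambda p,\lambda q,\lambda^2r)$, pseudo-norm $\|(p,q,r)\|_{\mathbb{H}}=((p^2+q^2)^2+r^2)^{1/4}$ and $\delta(x,y)=\|x^{-1}\ast y\|_{\mathbb{H}}$. Left-invariant fields: $X=\partial_p+2q\,\partial_r$, $Y=\partial_q-2p\,\partial_r$, $Z=\partial_r$. For $\alpha\in\{1,2,3\}^m$, $\nabla_{\mathbb{H}}^\alpha f=V_{\alpha_1}\cdots V_{\alpha_m}f$ with $V_1=X,V_2=Y,V_3=Z$, and $|\alpha|=\sum_i\omega(\alpha_i)$ with $\omega(1)=\omega(2)=1$, $\omega(3)=2$. The homogeneous degree of a polynomial $P(p,q,r)$ is obtained by giving $p,q$ weight 1 and $r$ weight 2. Global Hölder space: for $s=k+\sigma$ with $k=[s]\in\mathbb{N}$, $\sigma\in(0,1)$, $C^s(\mathbb{H})$ is the set of functions $f$ such that $\nabla_{\mathbb{H}}^\alpha f$ is continuous for $|\alpha|\le k$ and $$\|f\|_{C^s(\mathbb{H})}=\sup_{|\alpha|=k}\sup_{x\ne y}\frac{|\nabla_{\mathbb{H}}^\alpha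 f(x)-\nabla_{\mathbb{H}}^\alpha f(y)|}{\delta(x,y)^\sigma}<\infty;$$ the topology of $C^s(\mathbb{H})$ is the one defined by $\|\cdot\|_{C^s(\mathbb{H})}$. Pointwise regularity: for $f\in L^\infty_{loc}(\mathbb{H})$ and $u>0$, $f\in C^u(x_0)$ means that there are $C,\eta>0$ and a polynomial $P$ of homogeneous degree $<u$ with $|f(x_0x)-P(x)|\le C\|x\|_{\mathbb{H}}^u$ whenever $\|x\|_{\mathbb{H}}<\eta$. The pointwise exponent is $h_f(x_0)=\sup\{u>0: f\in C^u(x_0)\}$, with $h_f(x_0)=0$ if there is no such $u$. *)

theory Defs
  imports "HOL-Analysis.Analysis"
begin

section \<open>The Heisenberg group\<close>

type_synonym heis = "real \<times> real \<times> real"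

definition hmult :: "heis \<Rightarrow> heis \<Rightarrow> heis" where
  "hmult = (\<lambda>(p, q, r) (p', q', r'). (p + p', q + q', r + r' + 2 * (q * p' - p * q')))"

definition hinv :: "heis \<Rightarrow> heis" where
  "hinv x = - x"

definition hnorm :: "heis \<Rightarrow> real" where
  "hnorm = (\<lambda>(p, q, r). ((p\<^sup>2 + q\<^sup>2)\<^sup>2 + r\<^sup>2) powr (1/4))"

definition hdist :: "heis \<Rightarrow> heis \<Rightarrow> real" where
  "hdist x y = hnorm (hmult (hinv x) y)"

lemma hmult_hinv_left: "hmult (hinv x) x = 0"
  by (cases x) (simp add: hmult_def hinv_def zero_prod_def)


section \<open>Left-invariant derivatives\<close>

datatype hfield = FX | FY | FZ

fun fweight :: "hfield \<Rightarrow> nat" where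
  "fweight FX = 1"
| "fweight FY = 1"
| "fweight FZ = 2"

definition mweight :: "hfield list \<Rightarrow> nat" where
  "mweight \<alpha> = sum_list (map fweight \<alpha>)"

fun fvec :: "hfield \<Rightarrow> heis \<Rightarrow> heis" where
  "fvec FX (p, q, r) = (1, 0, 2 * q)"
| "fvec FY (p, q, r) = (0, 1, - 2 * p)"
| "fvec FZ (p, q, r) = (0, 0, 1)"

text \<open>
  A field acts on a function as the directional derivative along the value of the field at the
  point. Only this directional derivative has to exist, not the partial derivatives in the
  coordinates: functions of class \<open>C\<^sup>s\<close> with small \<open>s\<close> need not be
  differentiable in \<open>r\<close>.
\<close>

definition fdiff :: "hfield \<Rightarrow> (heis \<Rightarrow> real) \<Rightarrow> bool" where
  "fdiff V f \<longleftrightarrow> (\<forall>x. (\<lambda>t::real. f (x + t *\<^sub>R fvec V x)) differentiable (at 0))"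

definition fderiv :: "hfield \<Rightarrow> (heis \<Rightarrow> real) \<Rightarrow> heis \<Rightarrow> real" where
  "fderiv V f x = deriv (\<lambda>t::real. f (x + t *\<^sub>R fvec V x)) 0"

text \<open>The line followed by the directional derivative is the flow of the left-invariant field.\<close>

lemma fvec_flow:
  "x + t *\<^sub>R fvec FX x = hmult x (t, 0, 0)"
  "x + t *\<^sub>R fvec FY x = hmult x (0, t, 0)"
  "x + t *\<^sub>R fvec FZ x = hmult x (0, 0, t)"
  by (cases x; simp add: hmult_def algebra_simps)+

fun nablaH :: "hfield list \<Rightarrow> (heis \<Rightarrow> real) \<Rightarrow> heis \<Rightarrow> real" where
  "nablaH [] f = f"
| "nablaH (V # \<alpha>) f = fderiv V (nablaH \<alpha> f)"

fun nablaH_exists :: "hfield list \<Rightarrow> (heis \<Rightarrow> real) \<Rightarrow> bool" where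
  "nablaH_exists [] f \<longleftrightarrow> True"
| "nablaH_exists (V # \<alpha>) f \<longleftrightarrow> nablaH_exists \<alpha> f \<and> fdiff V (nablaH \<alpha> f)"


section \<open>The global space and its topology\<close>

text \<open>For \<open>s = k + \<sigma>\<close>, \<open>k\<close> is \<open>nat \<lfloor>s\<rfloor>\<close> and
  \<open>\<sigma>\<close> is \<open>frac s\<close>.\<close>

definition holder_norm :: "real \<Rightarrow> (heis \<Rightarrow> real) \<Rightarrow> ereal" where
  "holder_norm s f =
    (SUP \<alpha>\<in>{\<alpha>. mweight \<alpha> = nat \<lfloor>s\<rfloor>}. SUP (x, y)\<in>{(x, y). x \<noteq> y}.
       ereal (\<bar>nablaH \<alpha> f x - nablaH \<alpha> f y\<bar> / hdist x y powr frac s))"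

definition holder_space :: "real \<Rightarrow> (heis \<Rightarrow> real) set" where
  "holder_space s =
    {f. (\<forall>\<alpha>. mweight \<alpha> \<le> nat \<lfloor>s\<rfloor> \<longrightarrow>
           nablaH_exists \<alpha> f \<and> continuous_on UNIV (nablaH \<alpha> f)) \<and>
        holder_norm s f < \<infinity>}"

text \<open>
  \<open>holder_norm\<close> is only a seminorm (it vanishes on polynomials of homogeneous degree at
  most \<open>\<lfloor>s\<rfloor>\<close>), so this topology is not Hausdorff.
\<close>

definition holder_open :: "real \<Rightarrow> (heis \<Rightarrow> real) set \<Rightarrow> bool" where
  "holder_open s U \<longleftrightarrow> U \<subseteq> holder_space s \<and>
    (\<forall>f\<in>U. \<exists>e>0. \<forall>g\<in>holder_space s.
       holder_norm s (\<lambda>x. g x - f x) < ereal e \<longrightarrow> g \<in> U)"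

definition holder_topology :: "real \<Rightarrow> (heis \<Rightarrow> real) topology" where
  "holder_topology s = topology (holder_open s)"

lemma istopology_holder_open: "istopology (holder_open s)"
  unfolding istopology_def
proof (intro conjI allI impI)
  fix S T assume S: "holder_open s S" and T: "holder_open s T"
  show "holder_open s (S \<inter> T)"
    unfolding holder_open_def
  proof (intro conjI ballI)
    show "S \<inter> T \<subseteq> holder_space s" using S by (auto simp: holder_open_def)
  next
    fix f assume f: "f \<in> S \<inter> T"
    obtain d where d: "d > 0"
      "\<forall>g\<in>holder_space s. holder_norm s (\<lambda>x. g x - f x) < ereal d \<longrightarrow> g \<in> S"
      using S f unfolding holder_open_def by blast
    obtain e where e: "e > 0"
      "\<forall>g\<in>holder_space s. holder_norm s (\<lambda>x. g x - f x) < ereal e \<longrightarrow> g \<in> T"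
      using T f unfolding holder_open_def by blast
    have "holder_norm s (\<lambda>x. g x - f x) < ereal d \<and> holder_norm s (\<lambda>x. g x - f x) < ereal e"
      if "holder_norm s (\<lambda>x. g x - f x) < ereal (min d e)" for g
      using that by (auto simp: min_def less_le_trans split: if_splits)
    then show "\<exists>e>0. \<forall>g\<in>holder_space s.
        holder_norm s (\<lambda>x. g x - f x) < ereal e \<longrightarrow> g \<in> S \<inter> T"
      using d e by (intro exI[of _ "min d e"]) auto
  qed
next
  fix K assume K: "\<forall>S\<in>K. holder_open s S"
  show "holder_open s (\<Union>K)"
    unfolding holder_open_def
  proof (intro conjI ballI)
    show "\<Union>K \<subseteq> holder_space s" using K by (auto simp: holder_open_def)
  next
    fix f assume "f \<in> \<Union>K"
    then obtain S where S: "S \<in> K" "f \<in> S" by blast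
    then obtain e where "e > 0"
      "\<forall>g\<in>holder_space s. holder_norm s (\<lambda>x. g x - f x) < ereal e \<longrightarrow> g \<in> S"
      using K unfolding holder_open_def by blast
    with S show "\<exists>e>0. \<forall>g\<in>holder_space s.
        holder_norm s (\<lambda>x. g x - f x) < ereal e \<longrightarrow> g \<in> \<Union>K"
      by blast
  qed
qed

lemma openin_holder_topology: "openin (holder_topology s) = holder_open s"
  by (simp add: holder_topology_def istopology_holder_open topology_inverse')

lemma topspace_holder_topology: "topspace (holder_topology s) = holder_space s"
proof -
  have "holder_open s (holder_space s)"
    unfolding holder_open_def using zero_less_one by blast
  then show ?thesis
    unfolding topspace_def openin_holder_topology
    by (intro equalityI subsetI) (auto simp only: holder_open_def)
qed

definition dense_in_topology :: "'a topology \<Rightarrow> 'a set \<Rightarrow> bool" where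
  "dense_in_topology T S \<longleftrightarrow> S \<subseteq> topspace T \<and> T closure_of S = topspace T"

definition generic_in_topology :: "'a topology \<Rightarrow> 'a set \<Rightarrow> bool" where
  "generic_in_topology T S \<longleftrightarrow> S \<subseteq> topspace T \<and>
    (\<exists>U :: nat \<Rightarrow> 'a set. (\<forall>n. openin T (U n) \<and> dense_in_topology T (U n)) \<and> (\<Inter>n. U n) \<subseteq> S)"


section \<open>Pointwise regularity\<close>

definition hpoly_degree_less :: "real \<Rightarrow> (heis \<Rightarrow> real) \<Rightarrow> bool" where
  "hpoly_degree_less u P \<longleftrightarrow> (\<exists>c :: nat \<times> nat \<times> nat \<Rightarrow> real. \<forall>p q r.
     P (p, q, r) = (\<Sum>(i, j, l)\<in>{(i, j, l). real (i + j + 2 * l) < u}.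
                      c (i, j, l) * p ^ i * q ^ j * r ^ l))"

lemma finite_hpoly_indices: "finite {(i, j, l :: nat). real (i + j + 2 * l) < u}"
proof (rule finite_subset)
  show "{(i, j, l :: nat). real (i + j + 2 * l) < u} \<subseteq>
      {..nat \<lceil>u\<rceil>} \<times> {..nat \<lceil>u\<rceil>} \<times> {..nat \<lceil>u\<rceil>}"
    by (clarsimp, linarith)
qed simp

text \<open>
  Stated for arbitrary functions, but meant for locally bounded ones. It is only applied to
  elements of \<open>holder_space s\<close>, which are continuous (the case of the empty
  \<open>\<alpha>\<close>), hence locally bounded.
\<close>

definition pointwise_holder :: "real \<Rightarrow> heis \<Rightarrow> (heis \<Rightarrow> real) \<Rightarrow> bool" where
  "pointwise_holder u x0 f \<longleftrightarrow> (\<exists>C>0. \<exists>\<eta>>0. \<exists>P. hpoly_degree_less u P \<and>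
     (\<forall>x. hnorm x < \<eta> \<longrightarrow> \<bar>f (hmult x0 x) - P x\<bar> \<le> C * hnorm x powr u))"

definition pointwise_exponent :: "(heis \<Rightarrow> real) \<Rightarrow> heis \<Rightarrow> ereal" where
  "pointwise_exponent f x0 =
    (if \<exists>u>0. pointwise_holder u x0 f
     then SUP u\<in>{u. u > 0 \<and> pointwise_holder u x0 f}. ereal u else 0)"

end

theory Submission
  imports Defs "HOL-Computational_Algebra.Polynomial"
begin

text \<open>
  Write \<open>k = \<lfloor>s\<rfloor>\<close>. A Taylor expansion shows that every element of \<open>C\<^sup>s\<close> has exponent at least
  \<open>s\<close> everywhere. For the converse, restrict \<open>f\<close> to the lines \<open>t \<mapsto> y * (t, 0, 0)\<close>: there
  polynomials of homogeneous degree at most \<open>k\<close> are killed by differences of order \<open>k + 1\<close>, so if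
  at every scale \<open>N\<^bsup>-j\<^esup>\<close> and at every point of the dilated integer lattice the difference of order
  \<open>k + 1\<close> with step comparable to \<open>N\<^bsup>-j\<^esup>\<close> is at least \<open>c N\<^bsup>-js\<^esup>\<close>, then no exponent exceeds \<open>s\<close>.
  This condition, with \<open>c > 0\<close> depending on \<open>f\<close>, is open because these differences are at most
  \<open>\<parallel>f\<parallel> N\<^bsup>-js\<^esup>\<close>. It is dense because one may add to \<open>f\<close> a small lacunary series of signed bumps
  at the lattice points: for large \<open>N\<close> the scales hardly interact, and the signs are chosen such that
  each bump reinforces the difference of \<open>f\<close> at its place.
\<close>

section \<open>The group and its pseudo-norm\<close>

text \<open>The exponent must be bounded above at every point, not just at most points. Every x lies
  within a fixed multiple of \<open>N^-j\<close> of a lattice point of scale j; so if f were in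
  \<open>C^v(x)\<close> with s < v \<le> k + 1, the normalised differences near x would be
  O(\<open>N^(j(s - v))\<close>) and tend to 0. Lines along X suffice: on them a left-translated
  polynomial of homogeneous degree at most k is an ordinary polynomial of degree at most k. On the
  regularity side the obstacle is Z, which has weight 2: when a single order of smoothness is left,
  no Z-derivative is available, and vertical increments come from commutators of horizontal flows
  instead. The series works because s is not an integer. Seen from scale j, a coarser scale i is
  smooth, and k + 1 derivatives give the factor \<open>N^(-(1 - frac s)(j - i))\<close>; a finer one
  is small and gives \<open>N^(-s(i - j))\<close>. Both are at most \<open>\<rho>^|i - j|\<close>
  with \<open>\<rho> = N^(-min (frac s) (1 - frac s))\<close>, so N can be fixed from s and the bump
  alone, before f and before the size of the perturbation.\<close>

lemma hmult_assoc: "hmult (hmult x y) z = hmult x (hmult y z)"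
  by (cases x; cases y; cases z) (simp add: hmult_def algebra_simps)

lemma hmult_zero [simp]: "hmult x 0 = x" "hmult 0 x = x"
  by (cases x; simp add: hmult_def zero_prod_def)+

lemma hmult_hinv_right: "hmult x (hinv x) = 0"
  by (cases x) (simp add: hmult_def hinv_def zero_prod_def)

lemma hmult_hinv_cancel: "hmult (hinv x) (hmult x y) = y" "hmult x (hmult (hinv x) y) = y"
  by (simp_all add: hmult_hinv_left hmult_hinv_right flip: hmult_assoc)

lemma hinv_hmult: "hinv (hmult x y) = hmult (hinv y) (hinv x)"
  by (cases x; cases y) (simp add: hmult_def hinv_def algebra_simps)

lemma hdist_left_invariant: "hdist (hmult x y) (hmult x z) = hdist y z"
  by (simp add: hdist_def hinv_hmult hmult_assoc hmult_hinv_cancel)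

lemma hdist_hmult_right: "hdist x (hmult x z) = hnorm z"
  by (simp add: hdist_def hmult_hinv_cancel)

lemma hnorm_nonneg [simp]: "hnorm x \<ge> 0"
  by (cases x) (simp add: hnorm_def)

lemma hdist_nonneg [simp]: "hdist x y \<ge> 0"
  by (simp add: hdist_def)

lemma hnorm_pos: "x \<noteq> 0 \<Longrightarrow> hnorm x > 0"
proof -
  assume "x \<noteq> 0"
  obtain p q r where x: "x = (p, q, r)" by (cases x)
  have "(p\<^sup>2 + q\<^sup>2)\<^sup>2 + r\<^sup>2 \<noteq> 0"
    using \<open>x \<noteq> 0\<close> by (auto simp: x zero_prod_def add_nonneg_eq_0_iff)
  then show ?thesis by (simp add: x hnorm_def)
qed

lemma hdist_pos: "x \<noteq> y \<Longrightarrow> hdist x y > 0"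
proof -
  assume "x \<noteq> y"
  then have "hmult (hinv x) y \<noteq> 0"
    by (metis hmult_hinv_cancel(2) hmult_zero(1))
  then show ?thesis by (simp add: hdist_def hnorm_pos)
qed

lemma hdist_self [simp]: "hdist x x = 0"
  by (simp add: hdist_def hmult_hinv_left) (simp add: hnorm_def zero_prod_def)

lemma hnorm_power4: "hnorm (p, q, r) ^ 4 = (p\<^sup>2 + q\<^sup>2)\<^sup>2 + r\<^sup>2"
proof -
  have "(x powr (1/4)) ^ 4 = x" if "x \<ge> 0" for x :: real
  proof -
    have "(x powr (1/4)) ^ 4 = (x powr (1/4)) powr 4" by (rule powr_numeral[symmetric]) simp
    with that show ?thesis by (simp add: powr_powr)
  qed
  then show ?thesis by (simp add: hnorm_def)
qed

lemma hnorm_coords: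
  "\<bar>p\<bar> \<le> hnorm (p, q, r)" "\<bar>q\<bar> \<le> hnorm (p, q, r)" "\<bar>r\<bar> \<le> (hnorm (p, q, r))\<^sup>2"
proof -
  let ?n = "hnorm (p, q, r)"
  have 4: "?n ^ 4 = (p\<^sup>2 + q\<^sup>2)\<^sup>2 + r\<^sup>2" by (rule hnorm_power4)
  have "(p\<^sup>2)\<^sup>2 \<le> (p\<^sup>2 + q\<^sup>2)\<^sup>2" "(q\<^sup>2)\<^sup>2 \<le> (p\<^sup>2 + q\<^sup>2)\<^sup>2"
    by (intro power_mono; simp)+
  then have "(p\<^sup>2)\<^sup>2 \<le> (?n\<^sup>2)\<^sup>2" "(q\<^sup>2)\<^sup>2 \<le> (?n\<^sup>2)\<^sup>2"
    using 4 by (simp_all add: add_increasing2 flip: power_mult)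
  then have "p\<^sup>2 \<le> ?n\<^sup>2" "q\<^sup>2 \<le> ?n\<^sup>2"
    by (simp_all only: power2_le_imp_le zero_le_power2)
  then show "\<bar>p\<bar> \<le> ?n" "\<bar>q\<bar> \<le> ?n"
    by (simp_all flip: abs_le_square_iff)
  have "\<bar>r\<bar>\<^sup>2 \<le> (?n\<^sup>2)\<^sup>2" using 4 by simp
  then show "\<bar>r\<bar> \<le> ?n\<^sup>2" by (rule power2_le_imp_le) simp
qed

text \<open>4 + 9 = 13 \<le> 16. The factor 3 leaves room for the twist that the group law adds to
  the third coordinate.\<close>

lemma hnorm_le:
  assumes "\<bar>p\<bar> \<le> c" "\<bar>q\<bar> \<le> c" "\<bar>r\<bar> \<le> 3 * c\<^sup>2"
  shows "hnorm (p, q, r) \<le> 2 * c"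
proof -
  have c: "c \<ge> 0" using assms(1) by linarith
  have "p\<^sup>2 \<le> c\<^sup>2" "q\<^sup>2 \<le> c\<^sup>2" using assms c by (simp_all flip: abs_le_square_iff)
  then have "(p\<^sup>2 + q\<^sup>2)\<^sup>2 \<le> (2 * c\<^sup>2)\<^sup>2" by (intro power_mono) auto
  moreover have "r\<^sup>2 \<le> (3 * c\<^sup>2)\<^sup>2" using assms(3) by (metis abs_le_square_iff abs_ge_self order_trans)
  ultimately have "hnorm (p, q, r) ^ 4 \<le> 13 * c ^ 4"
    by (simp add: hnorm_power4 power_mult_distrib flip: power_mult)
  also have "\<dots> \<le> (2 * c) ^ 4" by (simp add: power_mult_distrib)
  finally show ?thesis using c
    by (meson hnorm_nonneg mult_nonneg_nonneg power_mono_iff zero_le_numeral zero_less_numeral)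
qed

section \<open>Dilations\<close>

definition hdil :: "real \<Rightarrow> heis \<Rightarrow> heis" where
  "hdil l = (\<lambda>(p, q, r). (l * p, l * q, l\<^sup>2 * r))"

lemma hdil_hmult: "hdil l (hmult x y) = hmult (hdil l x) (hdil l y)"
  by (cases x; cases y) (simp add: hdil_def hmult_def power2_eq_square algebra_simps)

lemma hdil_hdil: "hdil l (hdil m x) = hdil (l * m) x"
  by (cases x) (simp add: hdil_def power_mult_distrib mult.assoc)

lemma hdil_1 [simp]: "hdil 1 x = x"
  by (cases x) (simp add: hdil_def)

lemma hnorm_hdil:
  assumes "l \<ge> 0"
  shows "hnorm (hdil l x) = l * hnorm x"
proof -
  obtain p q r where x: "x = (p, q, r)" by (cases x)
  have "hnorm (hdil l x) ^ 4 = (l * hnorm x) ^ 4"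
    by (simp add: x hdil_def hnorm_power4 power_mult_distrib) (simp add: power2_eq_square power4_eq_xxxx algebra_simps)
  then show ?thesis
    using assms by (meson hnorm_nonneg mult_nonneg_nonneg power_eq_imp_eq_base zero_less_numeral)
qed

section \<open>Flows and derivatives\<close>

text \<open>The one-parameter subgroup generated by the field; right multiplication by it is the
  flow.\<close>

fun hexp :: "hfield \<Rightarrow> real \<Rightarrow> heis" where
  "hexp FX t = (t, 0, 0)"
| "hexp FY t = (0, t, 0)"
| "hexp FZ t = (0, 0, t)"

lemma flow_eq: "x + t *\<^sub>R fvec V x = hmult x (hexp V t)"
  by (cases V) (simp_all add: fvec_flow)

lemma hexp_add: "hmult (hexp V t) (hexp V u) = hexp V (t + u)"
  by (cases V) (simp_all add: hmult_def)

lemma hexp_0 [simp]: "hexp V 0 = 0"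
  by (cases V) (simp_all add: zero_prod_def)

lemma hdil_hexp: "hdil l (hexp V t) = hexp V (l ^ fweight V * t)"
  by (cases V) (simp_all add: hdil_def)

lemma hnorm_hexp:
  "hnorm (hexp FX t) = \<bar>t\<bar>" "hnorm (hexp FY t) = \<bar>t\<bar>" "hnorm (hexp FZ t) = sqrt \<bar>t\<bar>"
proof -
  have *: "((t\<^sup>2)\<^sup>2) powr (1/4) = \<bar>t\<bar>"
  proof (rule power_eq_imp_eq_base)
    show "(((t\<^sup>2)\<^sup>2) powr (1/4)) ^ 4 = \<bar>t\<bar> ^ 4"
      using hnorm_power4[of t 0 0] by (simp add: hnorm_def)
  qed auto
  then show "hnorm (hexp FX t) = \<bar>t\<bar>" "hnorm (hexp FY t) = \<bar>t\<bar>" by (simp_all add: hnorm_def)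
  show "hnorm (hexp FZ t) = sqrt \<bar>t\<bar>"
  proof (rule power_eq_imp_eq_base)
    have "sqrt \<bar>t\<bar> ^ 4 = (sqrt \<bar>t\<bar> ^ 2) ^ 2" by (simp only: flip: power_mult) simp
    also have "\<dots> = t\<^sup>2" by simp
    finally show "hnorm (hexp FZ t) ^ 4 = sqrt \<bar>t\<bar> ^ 4" by (simp add: hnorm_power4)
  qed auto
qed

text \<open>Existence and value of the derivative in one relation, so that iterated derivatives can
  be computed by induction on the word with the usual \<open>DERIV\<close> rules.\<close>

definition has_fderiv :: "hfield \<Rightarrow> (heis \<Rightarrow> real) \<Rightarrow> (heis \<Rightarrow> real) \<Rightarrow> bool" where
  "has_fderiv V f g \<longleftrightarrow>
    (\<forall>x. ((\<lambda>t. f (hmult x (hexp V t))) has_real_derivative g x) (at 0))"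

lemma has_fderivD:
  assumes "has_fderiv V f g"
  shows "fdiff V f" "fderiv V f = g"
  using assms
  by (auto simp: has_fderiv_def fdiff_def fderiv_def flow_eq fun_eq_iff real_differentiable_def
      intro: DERIV_imp_deriv)

lemma has_fderivI: "fdiff V f \<Longrightarrow> has_fderiv V f (fderiv V f)"
  by (auto simp: has_fderiv_def fdiff_def fderiv_def flow_eq DERIV_deriv_iff_real_differentiable)

text \<open>Left invariance: restarting the flow at \<open>hmult x (hexp V t)\<close> only shifts
  the time, so the derivative at time 0 for all base points gives it at all times.\<close>

lemma has_fderiv_flow:
  assumes "has_fderiv V f g"
  shows "((\<lambda>t. f (hmult x (hexp V t))) has_real_derivative g (hmult x (hexp V t))) (at t)"
proof -
  have "((\<lambda>u. f (hmult (hmult x (hexp V t)) (hexp V u))) has_real_derivative g (hmult x (hexp V t))) (at 0)"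
    using assms unfolding has_fderiv_def by blast
  then have "((\<lambda>u. f (hmult x (hexp V (u + t)))) has_real_derivative g (hmult x (hexp V t))) (at 0)"
    by (simp add: hmult_assoc hexp_add add.commute)
  then show ?thesis
    using DERIV_shift[of "\<lambda>u. f (hmult x (hexp V u))" _ 0 t] by simp
qed

lemma has_fderiv_add: "has_fderiv V f f' \<Longrightarrow> has_fderiv V g g' \<Longrightarrow>
    has_fderiv V (\<lambda>x. f x + g x) (\<lambda>x. f' x + g' x)"
  unfolding has_fderiv_def by (auto intro!: derivative_intros)

lemma has_fderiv_diff: "has_fderiv V f f' \<Longrightarrow> has_fderiv V g g' \<Longrightarrow>
    has_fderiv V (\<lambda>x. f x - g x) (\<lambda>x. f' x - g' x)"
  unfolding has_fderiv_def by (auto intro!: derivative_intros)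

lemma mweight_simps [simp]:
  "mweight [] = 0" "mweight (V # w) = fweight V + mweight w" "mweight (v @ w) = mweight v + mweight w"
  "mweight (replicate n V) = n * fweight V"
  by (simp_all add: mweight_def sum_list_replicate)

lemma has_fderiv_nablaH:
  assumes "nablaH_exists (V # w) f"
  shows "has_fderiv V (nablaH w f) (nablaH (V # w) f)"
  using assms by (simp add: has_fderivI)

lemma nablaH_add:
  assumes "nablaH_exists w f" "nablaH_exists w g"
  shows "nablaH_exists w (\<lambda>x. f x + g x) \<and> nablaH w (\<lambda>x. f x + g x) = (\<lambda>x. nablaH w f x + nablaH w g x)"
  using assms
proof (induction w)
  case (Cons V w)
  then have "has_fderiv V (nablaH w (\<lambda>x. f x + g x)) (\<lambda>x. fderiv V (nablaH w f) x + fderiv V (nablaH w g) x)"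
    by (auto intro!: has_fderiv_add has_fderivI)
  with Cons show ?case by (auto simp: has_fderivD)
qed simp

lemma nablaH_diff:
  assumes "nablaH_exists w f" "nablaH_exists w g"
  shows "nablaH_exists w (\<lambda>x. f x - g x) \<and> nablaH w (\<lambda>x. f x - g x) = (\<lambda>x. nablaH w f x - nablaH w g x)"
  using assms
proof (induction w)
  case (Cons V w)
  then have "has_fderiv V (nablaH w (\<lambda>x. f x - g x)) (\<lambda>x. fderiv V (nablaH w f) x - fderiv V (nablaH w g) x)"
    by (auto intro!: has_fderiv_diff has_fderivI)
  with Cons show ?case by (auto simp: has_fderivD)
qed simp

text \<open>Lagrange's remainder, with the last derivative compared to its value at
  \<open>x\<close>. Thus \<open>E m\<close> itself need not be differentiable; an increment bound
  suffices.\<close>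

lemma taylor_flow:
  assumes E: "\<And>i. i < m \<Longrightarrow> has_fderiv V (E i) (E (Suc i))"
    and M: "\<And>u. \<bar>u\<bar> \<le> \<bar>t\<bar> \<Longrightarrow> \<bar>E m (hmult x (hexp V u)) - E m x\<bar> \<le> M"
  shows "\<bar>E 0 (hmult x (hexp V t)) - (\<Sum>i\<le>m. E i x / fact i * t ^ i)\<bar> \<le> M * \<bar>t\<bar> ^ m"
proof -
  have M0: "M \<ge> 0" using M[of 0] by simp
  obtain u where u: "\<bar>u\<bar> \<le> \<bar>t\<bar>"
    "E 0 (hmult x (hexp V t)) =
     (\<Sum>i<m. E i (hmult x (hexp V 0)) / fact i * t ^ i) + E m (hmult x (hexp V u)) / fact m * t ^ m"
    using Maclaurin_bi_le[of "\<lambda>i t. E i (hmult x (hexp V t))" "\<lambda>t. E 0 (hmult x (hexp V t))" m t]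
      has_fderiv_flow[OF E] by auto
  have "E 0 (hmult x (hexp V t)) - (\<Sum>i\<le>m. E i x / fact i * t ^ i)
      = (E m (hmult x (hexp V u)) - E m x) * (t ^ m / fact m)"
    by (simp add: u(2) algebra_simps diff_divide_distrib flip: lessThan_Suc_atMost)
  also have "\<bar>\<dots>\<bar> \<le> M * (\<bar>t\<bar> ^ m / fact m)"
    unfolding abs_mult by (intro mult_mono M u) (auto simp: abs_mult power_abs M0)
  also have "\<dots> \<le> M * \<bar>t\<bar> ^ m"
    using M0 by (intro mult_left_mono) (auto simp: divide_le_eq mult_le_cancel_left1 fact_ge_1)
  finally show ?thesis .
qed

section \<open>Increments controlled by horizontal derivatives\<close>

lemma mean_value_flow:
  assumes "has_fderiv V F F'"
  obtains u where "\<bar>u\<bar> \<le> \<bar>t\<bar>" "F (hmult x (hexp V t)) - F x = t * F' (hmult x (hexp V u))"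
proof -
  have "\<exists>u. \<bar>u\<bar> \<le> \<bar>t\<bar> \<and> F (hmult x (hexp V t)) =
     (\<Sum>i<1. (\<lambda>i. if i = 0 then F else F') i (hmult x (hexp V 0)) / fact i * t ^ i) + F' (hmult x (hexp V u)) / fact 1 * t ^ 1"
    using Maclaurin_bi_le[of "\<lambda>i t. (if i = 0 then F else F') (hmult x (hexp V t))" "\<lambda>t. F (hmult x (hexp V t))" 1 t]
      has_fderiv_flow[OF assms] by auto
  then show ?thesis using that by (auto simp: algebra_simps)
qed

text \<open>The product of the four horizontal steps is \<open>hexp FZ (- 4 * a * b)\<close>. A
  vertical move by \<open>r\<close> thus costs horizontal steps of length
  \<open>sqrt \<bar>r\<bar> / 2\<close>; the sign of \<open>r\<close> is put into
  \<open>a\<close>.\<close>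

lemma vertical_commutator:
  obtains a b where "\<bar>a\<bar> = sqrt \<bar>r\<bar> / 2" "\<bar>b\<bar> = sqrt \<bar>r\<bar> / 2"
    "hexp FZ r = hmult (hmult (hmult (hexp FX a) (hexp FY b)) (hexp FX (- a))) (hexp FY (- b))"
proof
  define b where "b = sqrt \<bar>r\<bar> / 2"
  define a where "a = - sgn r * sqrt \<bar>r\<bar> / 2"
  show "\<bar>a\<bar> = sqrt \<bar>r\<bar> / 2" by (cases "r = 0") (auto simp: a_def abs_mult abs_sgn_eq)
  show "\<bar>b\<bar> = sqrt \<bar>r\<bar> / 2" by (simp add: b_def)
  have "-4 * a * b = sgn r * (sqrt \<bar>r\<bar> * sqrt \<bar>r\<bar>)" by (simp add: a_def b_def)
  also have "\<dots> = r" by (simp add: sgn_mult_abs)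
  finally have "r = - 4 * a * b" by simp
  then show "hexp FZ r = hmult (hmult (hmult (hexp FX a) (hexp FY b)) (hexp FX (- a))) (hexp FY (- b))"
    by (simp add: hmult_def algebra_simps)
qed

text \<open>Replaces the missing Z-derivative. Along the commutator path the two X-steps have
  opposite lengths, and so do the two Y-steps; the mean values therefore combine to differences of
  \<open>FX'\<close> and of \<open>FY'\<close> at points at distance at most 4c, c =
  \<open>sqrt \<bar>r\<bar>\<close>. Each step length c/2 times such a difference is of order
  \<open>c powr (1 + \<sigma>)\<close>.\<close>

lemma vertical_increment:
  assumes X: "has_fderiv FX F FX'" and Y: "has_fderiv FY F FY'" and H: "H \<ge> 0" and \<sigma>: "0 \<le> \<sigma>" "\<sigma> \<le> 1"
    and HX: "\<And>x y. \<bar>FX' x - FX' y\<bar> \<le> H * hdist x y powr \<sigma>"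
    and HY: "\<And>x y. \<bar>FY' x - FY' y\<bar> \<le> H * hdist x y powr \<sigma>"
  shows "\<bar>F (hmult x (hexp FZ r)) - F x\<bar> \<le> 4 * H * sqrt \<bar>r\<bar> powr (1 + \<sigma>)"
proof -
  define c where "c = sqrt \<bar>r\<bar>"
  have c: "c \<ge> 0" by (simp add: c_def)
  obtain a b where ab: "\<bar>a\<bar> = c / 2" "\<bar>b\<bar> = c / 2"
    and e: "hexp FZ r = hmult (hmult (hmult (hexp FX a) (hexp FY b)) (hexp FX (- a))) (hexp FY (- b))"
    using vertical_commutator[of r] by (auto simp: c_def)
  define x1 where "x1 = hmult x (hexp FX a)"
  define x2 where "x2 = hmult x1 (hexp FY b)"
  define x3 where "x3 = hmult x2 (hexp FX (- a))"
  define x4 where "x4 = hmult x3 (hexp FY (- b))"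
  have x4: "hmult x (hexp FZ r) = x4"
    unfolding e x4_def x3_def x2_def x1_def by (simp only: hmult_assoc)
  obtain u1 where u1: "\<bar>u1\<bar> \<le> \<bar>a\<bar>" "F x1 - F x = a * FX' (hmult x (hexp FX u1))"
    using mean_value_flow[OF X, of a x] unfolding x1_def by metis
  obtain u2 where u2: "\<bar>u2\<bar> \<le> \<bar>b\<bar>" "F x2 - F x1 = b * FY' (hmult x1 (hexp FY u2))"
    using mean_value_flow[OF Y, of b x1] unfolding x2_def by metis
  obtain u3 where u3: "\<bar>u3\<bar> \<le> \<bar>- a\<bar>" "F x3 - F x2 = - a * FX' (hmult x2 (hexp FX u3))"
    using mean_value_flow[OF X, of "- a" x2] unfolding x3_def by metis
  obtain u4 where u4: "\<bar>u4\<bar> \<le> \<bar>- b\<bar>" "F x4 - F x3 = - b * FY' (hmult x3 (hexp FY u4))"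
    using mean_value_flow[OF Y, of "- b" x3] unfolding x4_def by metis
  have prods: "\<bar>v * w\<bar> \<le> c\<^sup>2 / 4" if "\<bar>v\<bar> \<le> c / 2" "\<bar>w\<bar> \<le> c / 2" for v w
    using mult_mono[OF that] c by (simp add: abs_mult power2_eq_square)
  \<comment> \<open>Cancelling the common left factor leaves an explicit point with first two
    coordinates of order c and third of order c^2.\<close>
  have d1: "hdist (hmult x (hexp FX u1)) (hmult x2 (hexp FX u3)) \<le> 4 * c"
  proof -
    have "hdist (hmult x (hexp FX u1)) (hmult x2 (hexp FX u3))
        = hnorm (- u1 + a + u3, b, - 2 * (- u1 + a) * b + 2 * b * u3)"
      unfolding x2_def x1_def hmult_assoc hdist_left_invariant
      by (simp add: hdist_def hinv_def hmult_def algebra_simps)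
    also have "\<dots> \<le> 2 * (2 * c)"
    proof (rule hnorm_le)
      show "\<bar>- u1 + a + u3\<bar> \<le> 2 * c" "\<bar>b\<bar> \<le> 2 * c" using u1(1) u3(1) ab c by linarith+
      show "\<bar>- 2 * (- u1 + a) * b + 2 * b * u3\<bar> \<le> 3 * (2 * c)\<^sup>2"
        using prods[of u1 b, THEN abs_le_D1] prods[of u1 b, THEN abs_le_D2] prods[of a b, THEN abs_le_D1]
          prods[of a b, THEN abs_le_D2] prods[of b u3, THEN abs_le_D1] prods[of b u3, THEN abs_le_D2] u1(1) u3(1) ab
        by (simp add: algebra_simps power_mult_distrib abs_le_iff)
    qed
    finally show ?thesis by simp
  qed
  have d2: "hdist (hmult x1 (hexp FY u2)) (hmult x3 (hexp FY u4)) \<le> 4 * c"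
  proof -
    have "hdist (hmult x1 (hexp FY u2)) (hmult x3 (hexp FY u4))
        = hnorm (- a, b - u2 + u4, - 2 * (b - u2) * a + 2 * a * u4)"
      unfolding x3_def x2_def hmult_assoc hdist_left_invariant
      by (simp add: hdist_def hinv_def hmult_def algebra_simps)
    also have "\<dots> \<le> 2 * (2 * c)"
    proof (rule hnorm_le)
      show "\<bar>- a\<bar> \<le> 2 * c" "\<bar>b - u2 + u4\<bar> \<le> 2 * c" using u2(1) u4(1) ab c by linarith+
      show "\<bar>- 2 * (b - u2) * a + 2 * a * u4\<bar> \<le> 3 * (2 * c)\<^sup>2"
        using prods[of u2 a, THEN abs_le_D1] prods[of u2 a, THEN abs_le_D2] prods[of b a, THEN abs_le_D1]
          prods[of b a, THEN abs_le_D2] prods[of a u4, THEN abs_le_D1] prods[of a u4, THEN abs_le_D2] u2(1) u4(1) ab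
        by (simp add: algebra_simps power_mult_distrib abs_le_iff)
    qed
    finally show ?thesis by simp
  qed
  have pw: "d powr \<sigma> \<le> 4 * c powr \<sigma>" if "0 \<le> d" "d \<le> 4 * c" for d
  proof -
    have "d powr \<sigma> \<le> (4 * c) powr \<sigma>" using that \<sigma> by (intro powr_mono2) auto
    also have "\<dots> = 4 powr \<sigma> * c powr \<sigma>" using c by (simp add: powr_mult)
    also have "4 powr \<sigma> \<le> (4::real) powr 1" using \<sigma> by (intro powr_mono) auto
    finally show ?thesis by (simp add: mult_right_mono)
  qed
  have "F x4 - F x = a * (FX' (hmult x (hexp FX u1)) - FX' (hmult x2 (hexp FX u3)))
      + b * (FY' (hmult x1 (hexp FY u2)) - FY' (hmult x3 (hexp FY u4)))"
    using u1(2) u2(2) u3(2) u4(2) by (simp add: algebra_simps)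
  also have "\<bar>\<dots>\<bar> \<le> c / 2 * (H * (4 * c powr \<sigma>)) + c / 2 * (H * (4 * c powr \<sigma>))"
    by (intro order.trans[OF abs_triangle_ineq] add_mono; unfold abs_mult; intro mult_mono
        order.trans[OF HX] order.trans[OF HY] mult_left_mono pw d1 d2 H) (use ab c in auto)
  also have "\<dots> = 4 * H * (c powr 1 * c powr \<sigma>)" using c by (simp add: powr_one)
  also have "\<dots> = 4 * H * c powr (1 + \<sigma>)" by (simp only: powr_add)
  finally show ?thesis by (simp only: x4 c_def)
qed

lemma heis_decompose:
  "(p, q, r) = hmult (hmult (hexp FZ (r - 2 * p * q)) (hexp FY q)) (hexp FX p)"
  by (simp add: hmult_def algebra_simps)

lemma sqrt_vertical_le: "sqrt \<bar>r - 2 * p * q\<bar> \<le> 2 * hnorm (p, q, r)"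
proof -
  let ?n = "hnorm (p, q, r)"
  have "\<bar>p * q\<bar> \<le> ?n * ?n" unfolding abs_mult by (intro mult_mono hnorm_coords) auto
  then have "\<bar>r - 2 * p * q\<bar> \<le> (2 * ?n)\<^sup>2"
    using hnorm_coords(3)[of r p q] by (simp add: power_mult_distrib power2_eq_square)
  then show ?thesis by (rule real_le_lsqrt[rotated -1]) simp_all
qed

text \<open>Two points are joined by six horizontal segments: four form the commutator for the
  vertical factor, then one along Y and one along X. With n the distance, their total length is at
  most n + n + 2 * 2n, whence the 6.\<close>

lemma horizontal_lipschitz:
  assumes X: "has_fderiv FX F FX'" and Y: "has_fderiv FY F FY'"
    and AX: "\<And>x. \<bar>FX' x\<bar> \<le> A" and AY: "\<And>x. \<bar>FY' x\<bar> \<le> A"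
  shows "\<bar>F x - F y\<bar> \<le> 6 * A * hdist x y"
proof -
  have A: "A \<ge> 0" using AX[of 0] by linarith
  have sX: "\<bar>F (hmult x (hexp FX t)) - F x\<bar> \<le> \<bar>t\<bar> * A" for x t
    using mean_value_flow[OF X, of t x] AX by (metis abs_ge_zero abs_mult mult_left_mono)
  have sY: "\<bar>F (hmult x (hexp FY t)) - F x\<bar> \<le> \<bar>t\<bar> * A" for x t
    using mean_value_flow[OF Y, of t x] AY by (metis abs_ge_zero abs_mult mult_left_mono)
  obtain p q r where z: "hmult (hinv x) y = (p, q, r)" by (cases "hmult (hinv x) y")
  let ?n = "hnorm (p, q, r)"
  define r' where "r' = r - 2 * p * q"
  obtain a b where ab: "\<bar>a\<bar> = sqrt \<bar>r'\<bar> / 2" "\<bar>b\<bar> = sqrt \<bar>r'\<bar> / 2"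
    and e: "hexp FZ r' = hmult (hmult (hmult (hexp FX a) (hexp FY b)) (hexp FX (- a))) (hexp FY (- b))"
    by (rule vertical_commutator)
  define x1 where "x1 = hmult x (hexp FX a)"
  define x2 where "x2 = hmult x1 (hexp FY b)"
  define x3 where "x3 = hmult x2 (hexp FX (- a))"
  define x4 where "x4 = hmult x3 (hexp FY (- b))"
  define x5 where "x5 = hmult x4 (hexp FY q)"
  have y: "y = hmult x5 (hexp FX p)"
  proof -
    have "y = hmult x (p, q, r)" using z by (metis hmult_hinv_cancel(2))
    also have "\<dots> = hmult x5 (hexp FX p)"
      unfolding heis_decompose[of p q r] r'_def[symmetric] e x5_def x4_def x3_def x2_def x1_def
      by (simp only: hmult_assoc)
    finally show ?thesis .
  qed
  have chain: "\<bar>e - f\<bar> \<le> m \<Longrightarrow> \<bar>f - d\<bar> \<le> n \<Longrightarrow> \<bar>e - d\<bar> \<le> m + n" for d e f m n :: real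
    by linarith
  have "\<bar>F y - F x\<bar> \<le> \<bar>p\<bar> * A + (\<bar>q\<bar> * A + (\<bar>- b\<bar> * A + (\<bar>- a\<bar> * A + (\<bar>b\<bar> * A + \<bar>a\<bar> * A))))"
    using sX[of x5 p] sY[of x4 q] sY[of x3 "- b"] sX[of x2 "- a"] sY[of x1 b] sX[of x a]
    unfolding y[symmetric] x5_def[symmetric] x4_def[symmetric] x3_def[symmetric] x2_def[symmetric] x1_def[symmetric]
    by (intro chain)
  also have "\<dots> = (\<bar>p\<bar> + \<bar>q\<bar> + 2 * sqrt \<bar>r'\<bar>) * A" using ab by (simp add: algebra_simps)
  also have "\<dots> \<le> (6 * ?n) * A"
    using hnorm_coords[of p q r] hnorm_coords(2)[of q p r] sqrt_vertical_le[of r p q] A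
    by (intro mult_right_mono) (auto simp: r'_def)
  finally show ?thesis by (simp add: hdist_def z abs_minus_commute mult_ac)
qed

section \<open>Taylor expansion\<close>

text \<open>All estimates use this form instead of suprema in \<open>ereal\<close>. It may range
  over all pairs, because for x = y both sides are 0 (\<open>0 powr t = 0\<close>).\<close>

lemma holder_norm_le_iff:
  "holder_norm s f \<le> ereal H \<longleftrightarrow>
    (\<forall>w x y. mweight w = nat \<lfloor>s\<rfloor> \<longrightarrow> \<bar>nablaH w f x - nablaH w f y\<bar> \<le> H * hdist x y powr frac s)"
proof -
  have "\<bar>a\<bar> / hdist x y powr t \<le> H \<longleftrightarrow> \<bar>a\<bar> \<le> H * hdist x y powr t" if "x \<noteq> y" for a x y t
    using hdist_pos[OF that] by (simp add: divide_le_eq)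
  then show ?thesis
    unfolding holder_norm_def SUP_le_iff by (auto simp: case_prod_beta) (metis abs_zero diff_self hdist_nonneg hdist_self mult_zero_right order_refl powr_0)+
qed

lemma holder_spaceD:
  assumes "f \<in> holder_space s" "mweight w \<le> nat \<lfloor>s\<rfloor>"
  shows "nablaH_exists w f" "continuous_on UNIV (nablaH w f)"
  using assms by (auto simp: holder_space_def)

lemma holder_space_bound:
  assumes "f \<in> holder_space s"
  obtains H where "H \<ge> 0" "holder_norm s f \<le> ereal H"
proof -
  have "holder_norm s f < \<infinity>" using assms by (simp add: holder_space_def)
  then have "holder_norm s f \<le> ereal (max 0 (real_of_ereal (holder_norm s f)))"
    by (cases "holder_norm s f") auto
  then show ?thesis using that[of "max 0 (real_of_ereal (holder_norm s f))"] by simp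
qed

section \<open>Polynomials of bounded homogeneous degree\<close>

lemma hpoly_degree_less_cong: "hpoly_degree_less u P \<Longrightarrow> P = Q \<Longrightarrow> hpoly_degree_less u Q"
  by simp

lemma hpoly_degree_less_monomial:
  assumes "real (i + j + 2 * l) < u"
  shows "hpoly_degree_less u (\<lambda>(p, q, r). a * p ^ i * q ^ j * r ^ l)"
  unfolding hpoly_degree_less_def
proof (intro exI allI)
  fix p q r :: real
  have "(\<Sum>(i', j', l')\<in>{(i, j, l). real (i + j + 2 * l) < u}.
          (if (i', j', l') = (i, j, l) then a else 0) * p ^ i' * q ^ j' * r ^ l')
      = (\<Sum>x\<in>{(i, j, l). real (i + j + 2 * l) < u}. if x = (i, j, l) then a * p ^ i * q ^ j * r ^ l else 0)"
    by (intro sum.cong) (auto split: if_splits)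
  also have "\<dots> = a * p ^ i * q ^ j * r ^ l"
    using assms finite_hpoly_indices by (subst sum.delta) auto
  finally show "(case (p, q, r) of (p, q, r) \<Rightarrow> a * p ^ i * q ^ j * r ^ l) =
      (\<Sum>(i', j', l')\<in>{(i, j, l). real (i + j + 2 * l) < u}.
          (\<lambda>x. if x = (i, j, l) then a else 0) (i', j', l') * p ^ i' * q ^ j' * r ^ l')"
    by simp
qed

lemma hpoly_degree_less_add:
  assumes "hpoly_degree_less u P" "hpoly_degree_less u Q"
  shows "hpoly_degree_less u (\<lambda>x. P x + Q x)"
proof -
  obtain c d where
    "\<And>p q r. P (p, q, r) = (\<Sum>(i, j, l)\<in>{(i, j, l). real (i + j + 2 * l) < u}. c (i, j, l) * p ^ i * q ^ j * r ^ l)"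
    "\<And>p q r. Q (p, q, r) = (\<Sum>(i, j, l)\<in>{(i, j, l). real (i + j + 2 * l) < u}. d (i, j, l) * p ^ i * q ^ j * r ^ l)"
    using assms unfolding hpoly_degree_less_def by blast
  then show ?thesis
    unfolding hpoly_degree_less_def
    by (intro exI[of _ "\<lambda>x. c x + d x"]) (auto simp: case_prod_beta algebra_simps simp flip: sum.distrib)
qed

lemma hpoly_degree_less_zero: "hpoly_degree_less u (\<lambda>x. 0)"
  unfolding hpoly_degree_less_def by (intro exI[of _ "\<lambda>x. 0"]) (simp add: case_prod_beta)

lemma hpoly_degree_less_sum:
  assumes "\<And>i. i \<in> A \<Longrightarrow> hpoly_degree_less u (P i)"
  shows "hpoly_degree_less u (\<lambda>x. \<Sum>i\<in>A. P i x)"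
  using assms
  by (induction A rule: infinite_finite_induct) (auto simp: hpoly_degree_less_zero hpoly_degree_less_add)

text \<open>Both terms of r - 2pq have weight 2, so the binomial expansion stays within the
  homogeneous degree a + b + 2c. These are the monomials that the Taylor expansion below
  produces.\<close>

lemma hpoly_degree_less_vertical:
  assumes "real (a + b + 2 * c) < u"
  shows "hpoly_degree_less u (\<lambda>(p, q, r). A * p ^ a * q ^ b * (r - 2 * p * q) ^ c)"
proof (rule hpoly_degree_less_cong)
  show "hpoly_degree_less u (\<lambda>x. \<Sum>i\<le>c. (\<lambda>(p, q, r).
      (A * of_nat (c choose i) * (- 2) ^ (c - i)) * p ^ (a + (c - i)) * q ^ (b + (c - i)) * r ^ i) x)"
    by (intro hpoly_degree_less_sum hpoly_degree_less_monomial) (use assms in auto)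
  show "(\<lambda>x. \<Sum>i\<le>c. (\<lambda>(p, q, r).
      (A * of_nat (c choose i) * (- 2) ^ (c - i)) * p ^ (a + (c - i)) * q ^ (b + (c - i)) * r ^ i) x)
    = (\<lambda>(p, q, r). A * p ^ a * q ^ b * (r - 2 * p * q) ^ c)"
  proof
    fix x :: heis
    obtain p q r where x: "x = (p, q, r)" by (cases x)
    have "(r - 2 * p * q) ^ c = (\<Sum>i\<le>c. of_nat (c choose i) * r ^ i * (- 2 * p * q) ^ (c - i))"
      using binomial_ring[of r "- 2 * p * q" c] by simp
    moreover have "(- 2 * p * q) ^ n = (- 2) ^ n * p ^ n * q ^ n" for n by (simp only: power_mult_distrib)
    ultimately show "(\<Sum>i\<le>c. (\<lambda>(p, q, r).
        (A * of_nat (c choose i) * (- 2) ^ (c - i)) * p ^ (a + (c - i)) * q ^ (b + (c - i)) * r ^ i) x)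
      = (\<lambda>(p, q, r). A * p ^ a * q ^ b * (r - 2 * p * q) ^ c) x"
      by (simp only: x prod.case sum_distrib_left power_add mult_ac)
  qed
qed

text \<open>Nests expansions: the coefficients \<open>b i\<close> of one expansion are replaced by
  their own expansions \<open>c i\<close>.\<close>

lemma abs_diff_sum_le:
  fixes a :: real
  assumes "\<bar>a - (\<Sum>i\<le>m. b i * t i)\<bar> \<le> e" and "\<And>i. i \<le> m \<Longrightarrow> \<bar>t i\<bar> * \<bar>b i - c i\<bar> \<le> g"
  shows "\<bar>a - (\<Sum>i\<le>m. c i * t i)\<bar> \<le> e + real (Suc m) * g"
proof -
  have "\<bar>\<Sum>i\<le>m. (b i - c i) * t i\<bar> \<le> (\<Sum>i\<le>m. g)"
    using assms(2) by (intro order.trans[OF sum_abs] sum_mono) (auto simp: abs_mult mult.commute)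
  then have "\<bar>(\<Sum>i\<le>m. b i * t i) - (\<Sum>i\<le>m. c i * t i)\<bar> \<le> real (Suc m) * g"
    by (simp add: sum_subtractf left_diff_distrib)
  then show ?thesis using assms(1) by linarith
qed

lemma power_mult_powr:
  fixes x :: real
  assumes "x \<ge> 0"
  shows "x ^ n * x powr (t - real n) = (if x = 0 then 0 else x powr t)"
  using assms by (auto simp: powr_realpow[symmetric] powr_add[symmetric])

text \<open>Each Z uses up two orders, so \<open>m\<close> remaining orders allow
  \<open>m div 2\<close> vertical derivatives. If \<open>m\<close> is even, the last of them has top
  weight and its increments are bounded by the norm directly. If \<open>m\<close> is odd, one order
  is left, and \<open>vertical_increment\<close> turns it into the exponent 1 +
  \<open>frac s\<close> of \<open>sqrt \<bar>r\<bar>\<close>.\<close>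

lemma holder_taylor_vertical:
  assumes f: "f \<in> holder_space s" and H: "H \<ge> 0" "holder_norm s f \<le> ereal H"
    and w: "mweight w \<le> nat \<lfloor>s\<rfloor>" and s: "s \<ge> 0"
  defines "m \<equiv> nat \<lfloor>s\<rfloor> - mweight w"
  shows "\<bar>nablaH w f (hmult x (hexp FZ r)) -
      (\<Sum>c\<le>m div 2. nablaH (replicate c FZ @ w) f x / fact c * r ^ c)\<bar>
    \<le> 4 * H * sqrt \<bar>r\<bar> powr (s - mweight w)"
proof -
  define C where "C = m div 2"
  define E where "E c = nablaH (replicate c FZ @ w) f" for c
  define n where "n = m - 2 * C"
  define d where "d = sqrt \<bar>r\<bar>"
  have sk: "s = nat \<lfloor>s\<rfloor> + frac s" using s by (simp add: frac_def)
  have n: "n = 0 \<or> n = 1" "m = 2 * C + n" by (auto simp: n_def C_def)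
  have ex: "has_fderiv V (nablaH v f) (nablaH (V # v) f)" if "mweight (V # v) \<le> nat \<lfloor>s\<rfloor>" for V v
    using holder_spaceD(1)[OF f that] by (rule has_fderiv_nablaH)
  have Hb: "\<bar>nablaH v f x - nablaH v f y\<bar> \<le> H * hdist x y powr frac s" if "mweight v = nat \<lfloor>s\<rfloor>" for v x y
    using H(2) that unfolding holder_norm_le_iff by blast
  have E_inc: "\<bar>E C (hmult x (hexp FZ u)) - E C x\<bar> \<le> 4 * H * d powr (n + frac s)" if u: "\<bar>u\<bar> \<le> \<bar>r\<bar>" for u
  proof -
    have "\<bar>E C (hmult x (hexp FZ u)) - E C x\<bar> \<le> 4 * H * sqrt \<bar>u\<bar> powr (n + frac s)"
      using n(1)
    proof
      assume "n = 0"
      then have "mweight (replicate C FZ @ w) = nat \<lfloor>s\<rfloor>" using n(2) w by (simp add: m_def)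
      from Hb[OF this, of x "hmult x (hexp FZ u)"] \<open>n = 0\<close> H(1) show ?thesis
        unfolding E_def hdist_hmult_right hnorm_hexp
        by (simp add: abs_minus_commute)
    next
      assume n1: "n = 1"
      then have W: "mweight (replicate C FZ @ w) + 1 = nat \<lfloor>s\<rfloor>" using n(2) w by (simp add: m_def)
      have "\<bar>E C (hmult x (hexp FZ u)) - E C x\<bar> \<le> 4 * H * sqrt \<bar>u\<bar> powr (1 + frac s)"
        unfolding E_def
        by (rule vertical_increment[where FX' = "nablaH (FX # replicate C FZ @ w) f"
              and FY' = "nablaH (FY # replicate C FZ @ w) f"])
          (use W H(1) in \<open>auto intro!: ex Hb simp del: nablaH.simps simp: less_imp_le frac_lt_1\<close>)
      with n1 show ?thesis by simp
    qed
    also have "\<dots> \<le> 4 * H * d powr (n + frac s)"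
      using u H(1) by (intro mult_left_mono powr_mono2) (auto simp: d_def)
    finally show ?thesis .
  qed
  have "\<bar>E 0 (hmult x (hexp FZ r)) - (\<Sum>c\<le>C. E c x / fact c * r ^ c)\<bar> \<le> 4 * H * d powr (n + frac s) * \<bar>r\<bar> ^ C"
  proof (rule taylor_flow)
    fix i assume i: "i < C"
    show "has_fderiv FZ (E i) (E (Suc i))"
      unfolding E_def using i n w by (auto intro!: ex simp del: nablaH.simps simp: m_def simp flip: append_Cons)
         (auto simp: m_def intro!: ex[of FZ "replicate i FZ @ w", simplified])
  qed (rule E_inc)
  also have "\<bar>r\<bar> ^ C = d ^ (2 * C)" by (simp add: d_def power_mult)
  also have "4 * H * d powr (n + frac s) * d ^ (2 * C) = 4 * H * (d ^ (2 * C) * d powr ((s - mweight w) - real (2 * C)))"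
  proof -
    have "real n + frac s = s - mweight w - real (2 * C)"
      using sk n(2) w unfolding m_def by linarith
    then show ?thesis by simp
  qed
  also have "\<dots> \<le> 4 * H * d powr (s - mweight w)"
    using H(1) by (intro mult_left_mono, subst power_mult_powr) (auto simp: d_def)
  finally show ?thesis by (simp add: E_def C_def d_def)
qed

lemma holder_taylor_horizontal:
  assumes f: "f \<in> holder_space s" and H: "H \<ge> 0" "holder_norm s f \<le> ereal H" and V: "V = FX \<or> V = FY"
    and w: "mweight w \<le> nat \<lfloor>s\<rfloor>" and s: "s \<ge> 0"
  defines "m \<equiv> nat \<lfloor>s\<rfloor> - mweight w"
  shows "\<bar>nablaH w f (hmult x (hexp V t)) - (\<Sum>a\<le>m. nablaH (replicate a V @ w) f x / fact a * t ^ a)\<bar>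
    \<le> H * \<bar>t\<bar> powr (s - mweight w)"
proof -
  define E where "E c = nablaH (replicate c V @ w) f" for c
  have sk: "s = nat \<lfloor>s\<rfloor> + frac s" using s by (simp add: frac_def)
  have V1: "fweight V = 1" "hnorm (hexp V u) = \<bar>u\<bar>" for u using V hnorm_hexp by auto
  have "\<bar>E 0 (hmult x (hexp V t)) - (\<Sum>a\<le>m. E a x / fact a * t ^ a)\<bar> \<le> H * \<bar>t\<bar> powr frac s * \<bar>t\<bar> ^ m"
  proof (rule taylor_flow)
    fix i assume i: "i < m"
    have "has_fderiv V (nablaH (replicate i V @ w) f) (nablaH (V # (replicate i V @ w)) f)"
      by (rule has_fderiv_nablaH, rule holder_spaceD(1)[OF f]) (use i V1 in \<open>auto simp: m_def\<close>)
    then show "has_fderiv V (E i) (E (Suc i))" by (simp add: E_def)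
  next
    fix u assume u: "\<bar>u\<bar> \<le> \<bar>t\<bar>"
    have "mweight (replicate m V @ w) = nat \<lfloor>s\<rfloor>" using w V1 by (simp add: m_def)
    then have "\<bar>E m x - E m (hmult x (hexp V u))\<bar> \<le> H * hdist x (hmult x (hexp V u)) powr frac s"
      using H(2) unfolding holder_norm_le_iff E_def by blast
    also have "\<dots> \<le> H * \<bar>t\<bar> powr frac s"
      unfolding hdist_hmult_right V1 using H(1) u by (intro mult_left_mono powr_mono2) auto
    finally show "\<bar>E m (hmult x (hexp V u)) - E m x\<bar> \<le> H * \<bar>t\<bar> powr frac s"
      by (simp add: abs_minus_commute)
  qed
  also have "frac s = (s - mweight w) - real m" using sk w unfolding m_def by linarith
  also have "H * \<bar>t\<bar> powr (s - mweight w - real m) * \<bar>t\<bar> ^ m = H * (\<bar>t\<bar> ^ m * \<bar>t\<bar> powr ((s - mweight w) - real m))"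
    by simp
  also have "\<dots> \<le> H * \<bar>t\<bar> powr (s - mweight w)"
    using H(1) by (intro mult_left_mono, subst power_mult_powr) auto
  finally show ?thesis by (simp add: E_def)
qed

text \<open>
  The expansion is made successively along the factors of
  \<open>(p, q, r) = (0, 0, r - 2pq) * (0, q, 0) * (p, 0, 0)\<close>; for this order only the derivatives
  \<open>Z\<^sup>c Y\<^sup>b X\<^sup>a f\<close> occur, so that no commutation of derivatives is needed.
\<close>

lemma holder_space_pointwise:
  assumes f: "f \<in> holder_space s" and s: "s > 0" "s \<notin> \<nat>"
  shows "pointwise_holder s x0 f"
proof -
  obtain H where H: "H \<ge> 0" "holder_norm s f \<le> ereal H" using holder_space_bound[OF f] .
  have s0: "s \<ge> 0" using s by simp
  define k where "k = nat \<lfloor>s\<rfloor>"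
  have ks: "real k < s"
  proof -
    have "real k \<le> s" using s by (simp add: k_def)
    moreover have "real k \<noteq> s" using s(2) by auto
    ultimately show ?thesis by simp
  qed
  \<comment> \<open>The head of a word acts last, so X^a is applied first, then Y^b, then
    Z^c.\<close>
  define D where "D a b c = nablaH (replicate c FZ @ replicate b FY @ replicate a FX) f x0 / (fact a * fact b * fact c)" for a b c
  define P where "P = (\<lambda>x. \<Sum>a\<le>k. \<Sum>b\<le>k - a. \<Sum>c\<le>(k - a - b) div 2.
      (\<lambda>(p, q, r). D a b c * p ^ a * q ^ b * (r - 2 * p * q) ^ c) x)"
  have P: "hpoly_degree_less s P"
    unfolding P_def
  proof (intro hpoly_degree_less_sum hpoly_degree_less_vertical)
    fix a b c assume "a \<in> {..k}" "b \<in> {..k - a}" "c \<in> {..(k - a - b) div 2}"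
    then have "a + b + 2 * c \<le> k" by auto
    then have "real (a + b + 2 * c) \<le> real k" by linarith
    then show "real (a + b + 2 * c) < s" using ks by linarith
  qed
  \<comment> \<open>\<open>C\<close> is the error constant of the vertical expansion, with
    \<open>2 powr s\<close> from \<open>sqrt_vertical_le\<close>; \<open>K\<close> accumulates the
    errors of the three nested expansions, each of at most k + 1 terms.\<close>
  define C where "C = 4 * H * 2 powr s"
  define K where "K = H + real (Suc k) * (H + real (Suc k) * C)"
  have C: "C \<ge> 0" using H by (simp add: C_def)
  have main: "\<bar>f (hmult x0 x) - P x\<bar> \<le> K * hnorm x powr s" for x
  proof -
    obtain p q r where x: "x = (p, q, r)" by (cases x)
    define N where "N = hnorm x"
    have N: "N \<ge> 0" by (simp add: N_def)
    have pq: "\<bar>p\<bar> \<le> N" "\<bar>q\<bar> \<le> N" using hnorm_coords by (auto simp: N_def x)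
    define z where "z = hmult x0 (hexp FZ (r - 2 * p * q))"
    define y where "y = hmult z (hexp FY q)"
    define wX where "wX a = replicate a FX" for a
    define wY where "wY a b = replicate b FY @ wX a" for a b
    have powr_le: "N ^ n * N powr (t - real n) \<le> N powr t" for n t
      using N by (simp add: power_mult_powr)
    \<comment> \<open>The path runs from \<open>x0\<close> vertically to \<open>z\<close>, along Y
      to \<open>y\<close>, along X to the end. The errors are estimated in that order:
      \<open>inner\<close> expands at \<open>x0\<close> the coefficients needed at \<open>z\<close>,
      \<open>middle\<close> those needed at \<open>y\<close>.\<close>
    have inner: "\<bar>nablaH (wY a b) f z -
        (\<Sum>c\<le>(k - a - b) div 2. nablaH (replicate c FZ @ wY a b) f x0 / fact c * (r - 2 * p * q) ^ c)\<bar>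
        \<le> C * N powr (s - a - b)" if "a \<le> k" "b \<le> k - a" for a b
    proof -
      have wt: "mweight (wY a b) = a + b" by (simp add: wY_def wX_def)
      have "a + b \<le> k" using that by auto
      then have "real a + real b \<le> real k" by linarith
      then have e: "s - a - b \<ge> 0" using ks by linarith
      have "\<bar>nablaH (wY a b) f z -
        (\<Sum>c\<le>(k - a - b) div 2. nablaH (replicate c FZ @ wY a b) f x0 / fact c * (r - 2 * p * q) ^ c)\<bar>
        \<le> 4 * H * sqrt \<bar>r - 2 * p * q\<bar> powr (s - a - b)"
        using holder_taylor_vertical[OF f H _ s0, of "wY a b" x0 "r - 2 * p * q"] \<open>a + b \<le> k\<close>
        unfolding wt k_def[symmetric] z_def by (simp add: diff_diff_eq)
      also have "\<dots> \<le> 4 * H * (2 * N) powr (s - a - b)"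
        using sqrt_vertical_le[of r p q] e H(1) by (intro mult_left_mono powr_mono2) (auto simp: N_def x)
      also have "\<dots> = 4 * H * 2 powr (s - a - b) * N powr (s - a - b)"
        using N by (simp add: powr_mult)
      also have "\<dots> \<le> C * N powr (s - a - b)"
        unfolding C_def using H(1) by (intro mult_right_mono mult_left_mono powr_mono) auto
      finally show ?thesis .
    qed
    have middle: "\<bar>nablaH (wX a) f y - (\<Sum>b\<le>k - a.
         (\<Sum>c\<le>(k - a - b) div 2. nablaH (replicate c FZ @ wY a b) f x0 / fact c * (r - 2 * p * q) ^ c) / fact b * q ^ b)\<bar>
        \<le> (H + real (Suc k) * C) * N powr (s - a)" if a: "a \<le> k" for a
    proof -
      have wt: "mweight (wX a) = a" by (simp add: wX_def)
      have "real a \<le> real k" using a by simp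
      then have e: "s - a \<ge> 0" using ks by linarith
      have "\<bar>nablaH (wX a) f y - (\<Sum>b\<le>k - a.
         (\<Sum>c\<le>(k - a - b) div 2. nablaH (replicate c FZ @ wY a b) f x0 / fact c * (r - 2 * p * q) ^ c) / fact b * q ^ b)\<bar>
         \<le> H * N powr (s - a) + real (Suc (k - a)) * (C * N powr (s - a))"
      proof (rule abs_diff_sum_le)
        have "\<bar>nablaH (wX a) f y - (\<Sum>b\<le>k - a. nablaH (wY a b) f z / fact b * q ^ b)\<bar>
            \<le> H * \<bar>q\<bar> powr (s - a)"
          using holder_taylor_horizontal[OF f H _ _ s0, of FY "wX a" z q] a
          unfolding wt k_def[symmetric] y_def wY_def by simp
        also have "\<dots> \<le> H * N powr (s - a)" using H(1) pq e by (intro mult_left_mono powr_mono2) auto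
        finally show "\<bar>nablaH (wX a) f y - (\<Sum>b\<le>k - a. nablaH (wY a b) f z / fact b * q ^ b)\<bar>
            \<le> H * N powr (s - a)" .
        fix b assume b: "b \<le> k - a"
        have "\<bar>q ^ b\<bar> * \<bar>nablaH (wY a b) f z / fact b -
            (\<Sum>c\<le>(k - a - b) div 2. nablaH (replicate c FZ @ wY a b) f x0 / fact c * (r - 2 * p * q) ^ c) / fact b\<bar>
          \<le> N ^ b * (C * N powr (s - a - b))"
        proof (rule mult_mono)
          show "\<bar>q ^ b\<bar> \<le> N ^ b" using pq by (simp add: power_abs power_mono)
          have "\<bar>t / fact b - u / fact b\<bar> \<le> \<bar>t - u\<bar>" for t u :: real
            by (simp add: divide_le_eq mult_le_cancel_left1 fact_ge_1 flip: diff_divide_distrib)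
          from order.trans[OF this inner[OF a b]]
          show "\<bar>nablaH (wY a b) f z / fact b -
            (\<Sum>c\<le>(k - a - b) div 2. nablaH (replicate c FZ @ wY a b) f x0 / fact c * (r - 2 * p * q) ^ c) / fact b\<bar>
            \<le> C * N powr (s - a - b)" .
        qed (use N in auto)
        also have "\<dots> = C * (N ^ b * N powr (s - a - b))" by simp
        also have "\<dots> \<le> C * N powr (s - a)" using C by (intro mult_left_mono powr_le)
        finally show "\<bar>q ^ b\<bar> * \<bar>nablaH (wY a b) f z / fact b -
            (\<Sum>c\<le>(k - a - b) div 2. nablaH (replicate c FZ @ wY a b) f x0 / fact c * (r - 2 * p * q) ^ c) / fact b\<bar>
          \<le> C * N powr (s - a)" .
      qed
      also have "\<dots> = (H + real (Suc (k - a)) * C) * N powr (s - a)" by (simp add: algebra_simps)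
      also have "\<dots> \<le> (H + real (Suc k) * C) * N powr (s - a)"
        using C by (intro mult_right_mono add_left_mono) auto
      finally show ?thesis .
    qed
    have HC: "H + real (Suc k) * C \<ge> 0" using H C by simp
    have "\<bar>f (hmult y (hexp FX p)) - (\<Sum>a\<le>k. (\<Sum>b\<le>k - a.
         (\<Sum>c\<le>(k - a - b) div 2. nablaH (replicate c FZ @ wY a b) f x0 / fact c * (r - 2 * p * q) ^ c) / fact b * q ^ b) / fact a * p ^ a)\<bar>
         \<le> H * N powr s + real (Suc k) * ((H + real (Suc k) * C) * N powr s)"
    proof (rule abs_diff_sum_le)
      have "\<bar>f (hmult y (hexp FX p)) - (\<Sum>a\<le>k. nablaH (wX a) f y / fact a * p ^ a)\<bar> \<le> H * \<bar>p\<bar> powr s"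
        using holder_taylor_horizontal[OF f H _ _ s0, of FX "[]" y p]
        unfolding k_def[symmetric] wX_def by simp
      also have "\<dots> \<le> H * N powr s" using H(1) pq s by (intro mult_left_mono powr_mono2) auto
      finally show "\<bar>f (hmult y (hexp FX p)) - (\<Sum>a\<le>k. nablaH (wX a) f y / fact a * p ^ a)\<bar> \<le> H * N powr s" .
      fix a assume a: "a \<le> k"
      let ?S = "\<Sum>b\<le>k - a. (\<Sum>c\<le>(k - a - b) div 2. nablaH (replicate c FZ @ wY a b) f x0 / fact c * (r - 2 * p * q) ^ c) / fact b * q ^ b"
      have "\<bar>p ^ a\<bar> * \<bar>nablaH (wX a) f y / fact a - ?S / fact a\<bar>
          \<le> N ^ a * ((H + real (Suc k) * C) * N powr (s - a))"
      proof (rule mult_mono)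
        show "\<bar>p ^ a\<bar> \<le> N ^ a" using pq by (simp add: power_abs power_mono)
        have "\<bar>t / fact a - u / fact a\<bar> \<le> \<bar>t - u\<bar>" for t u :: real
          by (simp add: divide_le_eq mult_le_cancel_left1 fact_ge_1 flip: diff_divide_distrib)
        from order.trans[OF this middle[OF a]]
        show "\<bar>nablaH (wX a) f y / fact a - ?S / fact a\<bar> \<le> (H + real (Suc k) * C) * N powr (s - a)" .
      qed (use N in auto)
      also have "\<dots> = (H + real (Suc k) * C) * (N ^ a * N powr (s - a))" by simp
      also have "\<dots> \<le> (H + real (Suc k) * C) * N powr s" using HC by (intro mult_left_mono powr_le)
      finally show "\<bar>p ^ a\<bar> * \<bar>nablaH (wX a) f y / fact a - ?S / fact a\<bar> \<le> (H + real (Suc k) * C) * N powr s" .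
    qed
    also have "\<dots> = K * N powr s" by (simp add: K_def algebra_simps)
    also have "hmult y (hexp FX p) = hmult x0 x"
      unfolding y_def z_def x heis_decompose[of p q r] by (simp only: hmult_assoc)
    also have "(\<Sum>a\<le>k. (\<Sum>b\<le>k - a.
         (\<Sum>c\<le>(k - a - b) div 2. nablaH (replicate c FZ @ wY a b) f x0 / fact c * (r - 2 * p * q) ^ c) / fact b * q ^ b) / fact a * p ^ a) = P x"
      unfolding P_def D_def wY_def wX_def x
      by (simp add: sum_distrib_left sum_distrib_right sum_divide_distrib mult_ac)
    finally show ?thesis by (simp add: N_def)
  qed
  have "K \<ge> 0" unfolding K_def using H C by simp
  show ?thesis
    unfolding pointwise_holder_def
  proof (intro exI conjI allI impI)
    \<comment> \<open>\<open>K\<close> may be 0, while the definition asks for a positive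
      constant.\<close>
    fix x show "\<bar>f (hmult x0 x) - P x\<bar> \<le> (K + 1) * hnorm x powr s"
      using main[of x] by (simp add: algebra_simps add_increasing)
  next
    show "(1::real) > 0" by simp
  qed (use \<open>K \<ge> 0\<close> P in auto)
qed

text \<open>The polynomial is truncated: a dropped monomial has weight at least \<open>v\<close>,
  hence is O(\<open>hnorm z powr v\<close>) for \<open>hnorm z < 1\<close>. This allows the exponent
  to be lowered to at most k + 1, where differences of order k + 1 kill the polynomial.\<close>

lemma pointwise_holder_mono:
  assumes "pointwise_holder u x f" "v \<le> u" "v > 0"
  shows "pointwise_holder v x f"
proof -
  obtain C \<eta> P where C: "C > 0" and \<eta>: "\<eta> > 0" and P: "hpoly_degree_less u P"
    and b: "\<And>z. hnorm z < \<eta> \<Longrightarrow> \<bar>f (hmult x z) - P z\<bar> \<le> C * hnorm z powr u"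
    using assms(1) unfolding pointwise_holder_def by blast
  let ?I = "\<lambda>u. {(i, j, l :: nat). real (i + j + 2 * l) < u}"
  obtain c where c: "\<And>p q r. P (p, q, r) = (\<Sum>(i, j, l)\<in>?I u. c (i, j, l) * p ^ i * q ^ j * r ^ l)"
    using P unfolding hpoly_degree_less_def by blast
  define Q where "Q = (\<lambda>(p, q, r). \<Sum>(i, j, l)\<in>?I v. c (i, j, l) * p ^ i * q ^ j * r ^ l)"
  define K where "K = (\<Sum>m\<in>?I u - ?I v. \<bar>c m\<bar>)"
  have K: "K \<ge> 0" by (simp add: K_def sum_nonneg)
  have sub: "?I v \<subseteq> ?I u" using assms(2) by auto
  have PQ: "\<bar>P z - Q z\<bar> \<le> K * hnorm z powr v" if z: "hnorm z < 1" for z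
  proof -
    obtain p q r where zz: "z = (p, q, r)" by (cases z)
    let ?n = "hnorm z"
    have eq: "P z - Q z = (\<Sum>(i, j, l)\<in>?I u - ?I v. c (i, j, l) * p ^ i * q ^ j * r ^ l)" (is "_ = ?S")
      unfolding zz c Q_def prod.case
      using sum.subset_diff[OF sub finite_hpoly_indices[of u], where g = "\<lambda>(i, j, l). c (i, j, l) * p ^ i * q ^ j * r ^ l"]
      by simp
    have "\<bar>?S\<bar> \<le> (\<Sum>m\<in>?I u - ?I v. \<bar>c m\<bar> * ?n powr v)"
    proof (rule order.trans[OF sum_abs], rule sum_mono)
      fix m assume m: "m \<in> ?I u - ?I v"
      obtain i j l where ijl: "m = (i, j, l)" by (cases m)
      have v: "v \<le> real (i + j + 2 * l)" using m by (auto simp: ijl)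
      have "\<bar>p ^ i * q ^ j * r ^ l\<bar> \<le> ?n ^ i * ?n ^ j * (?n\<^sup>2) ^ l"
        unfolding abs_mult power_abs zz by (intro mult_mono power_mono hnorm_coords) auto
      also have "\<dots> = ?n ^ (i + j + 2 * l)" by (simp add: power_add power_mult)
      also have "\<dots> \<le> ?n powr v"
      proof (cases "?n = 0")
        \<comment> \<open>The right side is 0 here, so the exponent on the left must not be 0; it is
          at least v > 0.\<close>
        case True
        then show ?thesis using v assms(3) by (cases "i + j + 2 * l = 0") (simp_all add: power_0_left)
      next
        case False
        then have "?n > 0" using hnorm_nonneg[of z] by linarith
        then show ?thesis using z v by (simp add: powr_mono' flip: powr_realpow)
      qed
      finally have "\<bar>c m\<bar> * \<bar>p ^ i * q ^ j * r ^ l\<bar> \<le> \<bar>c m\<bar> * ?n powr v" by (intro mult_left_mono) auto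
      then show "\<bar>case m of (i, j, l) \<Rightarrow> c (i, j, l) * p ^ i * q ^ j * r ^ l\<bar> \<le> \<bar>c m\<bar> * ?n powr v"
        by (simp add: ijl abs_mult mult_ac)
    qed
    then show ?thesis by (simp only: eq K_def sum_distrib_right)
  qed
  show ?thesis
    unfolding pointwise_holder_def
  proof (intro exI conjI allI impI)
    show "C + K > 0" "min \<eta> 1 > 0" using C K \<eta> by auto
    show "hpoly_degree_less v Q" unfolding hpoly_degree_less_def Q_def by auto
    fix z assume z: "hnorm z < min \<eta> 1"
    have "\<bar>f (hmult x z) - P z\<bar> \<le> C * hnorm z powr u" using b z by simp
    also have "\<dots> \<le> C * hnorm z powr v"
      using z assms C by (intro mult_left_mono powr_mono') auto
    finally show "\<bar>f (hmult x z) - Q z\<bar> \<le> (C + K) * hnorm z powr v"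
      using PQ[of z] z by (simp add: distrib_right)
  qed
qed

section \<open>Finite differences along horizontal lines\<close>

fun fdelta :: "nat \<Rightarrow> real \<Rightarrow> (real \<Rightarrow> real) \<Rightarrow> real \<Rightarrow> real" where
  "fdelta 0 h u t = u t"
| "fdelta (Suc m) h u t = fdelta m h u (t + h) - fdelta m h u t"

text \<open>The extra difference is moved inside, so that an induction can act on the function
  rather than on the point.\<close>

lemma fdelta_Suc': "fdelta (Suc m) h u t = fdelta m h (\<lambda>t. u (t + h) - u t) t"
proof (induction m arbitrary: t)
  case (Suc m)
  show ?case using Suc[of t] Suc[of "t + h"] by (metis fdelta.simps(2))
qed simp

lemma fdelta_add: "fdelta m h (\<lambda>t. u t + v t) t = fdelta m h u t + fdelta m h v t"
  by (induction m arbitrary: t) auto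

lemma fdelta_diff: "fdelta m h (\<lambda>t. u t - v t) t = fdelta m h u t - fdelta m h v t"
  by (induction m arbitrary: t) auto

lemma fdelta_abs_le:
  assumes "\<And>i. i \<le> m \<Longrightarrow> \<bar>u (t + real i * h)\<bar> \<le> M"
  shows "\<bar>fdelta m h u t\<bar> \<le> 2 ^ m * M"
  using assms
proof (induction m arbitrary: t)
  case 0
  show ?case using 0[of 0] by simp
next
  case (Suc m)
  have "\<bar>fdelta m h u (t + h)\<bar> \<le> 2 ^ m * M"
    using Suc.prems[of "Suc i" for i] by (intro Suc.IH) (simp add: algebra_simps)
  moreover have "\<bar>fdelta m h u t\<bar> \<le> 2 ^ m * M"
    using Suc.prems by (intro Suc.IH) simp
  ultimately show ?case by simp
qed

text \<open>Isolates the node t, where the forward difference has weight (-1)^m. It will be applied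
  to a bump so narrow that the other nodes miss it.\<close>

lemma fdelta_single:
  assumes "\<And>i. 1 \<le> i \<Longrightarrow> i \<le> m \<Longrightarrow> u (t + real i * h) = 0"
  shows "fdelta m h u t = (- 1) ^ m * u t"
  using assms
proof (induction m)
  case (Suc m)
  have "\<bar>fdelta m h u (t + h)\<bar> \<le> 2 ^ m * 0"
    using Suc.prems[of "Suc i" for i] by (intro fdelta_abs_le) (simp add: algebra_simps)
  then show ?case using Suc by simp
qed simp

text \<open>One difference is traded for one derivative at a time by the mean value
  inequality.\<close>

lemma fdelta_deriv_le:
  assumes "\<And>i t. i < m \<Longrightarrow> (u i has_real_derivative u (Suc i) t) (at t)"
    and "\<And>t. \<bar>u m t\<bar> \<le> M"
  shows "\<bar>fdelta m h (u 0) t\<bar> \<le> \<bar>h\<bar> ^ m * M"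
  using assms
proof (induction m arbitrary: u M)
  case 0
  show ?case using 0(2)[of t] by simp
next
  case (Suc m)
  define v where "v i t = u i (t + h) - u i t" for i t
  have "\<bar>fdelta m h (v 0) t\<bar> \<le> \<bar>h\<bar> ^ m * (\<bar>h\<bar> * M)"
  proof (rule Suc.IH)
    fix i t assume "i < m"
    then have "(u i has_real_derivative u (Suc i) t) (at t)" for t using Suc.prems(1)[of i] by simp
    from this[of "t + h", unfolded DERIV_shift] this[of t]
    show "(v i has_real_derivative v (Suc i) t) (at t)"
      unfolding v_def by (auto intro!: derivative_intros)
  next
    fix t
    have "norm (u m (t + h) - u m t) \<le> M * norm (t + h - t)"
    proof (rule field_differentiable_bound)
      fix z show "(u m has_field_derivative u (Suc m) z) (at z within UNIV)" using Suc.prems(1)[of m] by simp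
      show "norm (u (Suc m) z) \<le> M" using Suc.prems(2) by simp
    qed auto
    then show "\<bar>v m t\<bar> \<le> \<bar>h\<bar> * M" by (simp add: v_def mult.commute)
  qed
  then show ?case unfolding fdelta_Suc' v_def by (simp add: mult_ac)
qed

text \<open>One difference more than there are derivatives: the last one stays an increment of the
  top derivative, to which the Hoelder condition applies.\<close>

lemma fdelta_Suc_deriv_le:
  assumes "\<And>i t. i < m \<Longrightarrow> (u i has_real_derivative u (Suc i) t) (at t)"
    and "\<And>t. \<bar>u m (t + h) - u m t\<bar> \<le> M"
  shows "\<bar>fdelta (Suc m) h (u 0) t\<bar> \<le> \<bar>h\<bar> ^ m * M"
  unfolding fdelta_Suc'
proof (rule fdelta_deriv_le[where u = "\<lambda>i t. u i (t + h) - u i t"])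
  fix i t assume "i < m"
  then have "(u i has_real_derivative u (Suc i) t) (at t)" for t using assms(1) by simp
  from this[of "t + h", unfolded DERIV_shift] this[of t]
  show "((\<lambda>t. u i (t + h) - u i t) has_real_derivative u (Suc i) (t + h) - u (Suc i) t) (at t)"
    by (auto intro!: derivative_intros)
qed (rule assms(2))

lemma fdelta_poly:
  assumes "degree p \<le> m"
  shows "fdelta (Suc m) h (poly p) t = 0"
proof -
  have "degree ((pderiv ^^ i) p) = degree p - i" for i
    by (induction i) (simp_all add: degree_pderiv)
  then have "degree ((pderiv ^^ m) p) = 0" using assms by simp
  then have z: "(pderiv ^^ Suc m) p = 0" by (simp add: pderiv_eq_0_iff)
  have "\<bar>fdelta (Suc m) h (poly ((pderiv ^^ 0) p)) t\<bar> \<le> \<bar>h\<bar> ^ Suc m * 0"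
    by (rule fdelta_deriv_le[where u = "\<lambda>i. poly ((pderiv ^^ i) p)"])
       (simp_all only: z poly_0 abs_zero order_refl, simp add: poly_DERIV)
  then show ?thesis by simp
qed

lemma fdelta_suminf:
  assumes "\<And>t. summable (\<lambda>j. U j t)"
  shows "summable (\<lambda>j. fdelta m h (U j) t)"
    and "fdelta m h (\<lambda>t. \<Sum>j. U j t) t = (\<Sum>j. fdelta m h (U j) t)"
proof -
  have "summable (\<lambda>j. fdelta m h (U j) t) \<and> fdelta m h (\<lambda>t. \<Sum>j. U j t) t = (\<Sum>j. fdelta m h (U j) t)"
    by (induction m arbitrary: t) (auto simp: assms summable_diff suminf_diff)
  then show "summable (\<lambda>j. fdelta m h (U j) t)"
    and "fdelta m h (\<lambda>t. \<Sum>j. U j t) t = (\<Sum>j. fdelta m h (U j) t)" by auto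
qed

text \<open>Along the line, p = z1 + t and r = z3 + 2 z2 t are affine and q is constant, so a
  monomial of indices i, j, l has degree at most i + l \<le> i + j + 2l \<le> m in t.\<close>

lemma fdelta_hpoly:
  assumes P: "hpoly_degree_less u P" and u: "u \<le> real (Suc m)"
  shows "fdelta (Suc m) h (\<lambda>t. P (hmult z (hexp FX t))) t = 0"
proof -
  let ?I = "{(i, j, l :: nat). real (i + j + 2 * l) < u}"
  obtain c where c: "\<And>p q r. P (p, q, r) = (\<Sum>(i, j, l)\<in>?I. c (i, j, l) * p ^ i * q ^ j * r ^ l)"
    using P unfolding hpoly_degree_less_def by blast
  obtain z1 z2 z3 where z: "z = (z1, z2, z3)" by (cases z)
  define p where "p = (\<Sum>(i, j, l)\<in>?I. smult (c (i, j, l) * z2 ^ j) ([:z1, 1:] ^ i * [:z3, 2 * z2:] ^ l))"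
  have "P (hmult z (hexp FX t)) = poly p t" for t
    unfolding p_def poly_sum z hexp.simps hmult_def prod.case c
    by (intro sum.cong) (auto simp: poly_power algebra_simps)
  moreover have "degree p \<le> m"
    unfolding p_def
  proof (rule degree_sum_le[OF finite_hpoly_indices])
    fix x assume x: "x \<in> ?I"
    obtain i j l where ijl: "x = (i, j, l)" by (cases x)
    have "real (i + j + 2 * l) < real (Suc m)" using x u by (auto simp: ijl)
    then have il: "i + l \<le> m" by linarith
    have "degree ([:z1, 1:] ^ i * [:z3, 2 * z2:] ^ l) \<le> degree ([:z1, 1:] ^ i) + degree ([:z3, 2 * z2:] ^ l)"
      by (rule degree_mult_le)
    also have "\<dots> \<le> degree [:z1, 1:] * i + degree [:z3, 2 * z2:] * l"
      by (intro add_mono degree_power_le)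
    also have "\<dots> \<le> 1 * i + 1 * l" by (intro add_mono mult_right_mono) auto
    finally show "degree (case x of (i, j, l) \<Rightarrow> smult (c (i, j, l) * z2 ^ j) ([:z1, 1:] ^ i * [:z3, 2 * z2:] ^ l)) \<le> m"
      using il by (auto simp: ijl intro: order.trans[OF degree_smult_le])
  qed
  ultimately show ?thesis by (simp add: fdelta_poly del: fdelta.simps)
qed

text \<open>The line need not pass through \<open>x\<close>; only its nodes have to be near. So the
  lattice point close to \<open>x\<close> can serve as base point.\<close>

lemma pointwise_holder_fdelta:
  assumes "pointwise_holder u x f" "u > 0" "u \<le> real (Suc m)"
  obtains K \<eta> where "K > 0" "\<eta> > 0"
    "\<And>z h \<rho>. (\<And>i. i \<le> Suc m \<Longrightarrow> hnorm (hmult z (hexp FX (real i * h))) \<le> \<rho>) \<Longrightarrow> \<rho> < \<eta> \<Longrightarrow>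
       \<bar>fdelta (Suc m) h (\<lambda>t. f (hmult (hmult x z) (hexp FX t))) 0\<bar> \<le> K * \<rho> powr u"
proof -
  obtain C \<eta> P where C: "C > 0" and \<eta>: "\<eta> > 0" and P: "hpoly_degree_less u P"
    and b: "\<And>z. hnorm z < \<eta> \<Longrightarrow> \<bar>f (hmult x z) - P z\<bar> \<le> C * hnorm z powr u"
    using assms(1) unfolding pointwise_holder_def by blast
  show thesis
  proof (rule that)
    show "2 ^ Suc m * C > 0" "\<eta> > 0" using C \<eta> by auto
    fix z h \<rho>
    assume z: "\<And>i. i \<le> Suc m \<Longrightarrow> hnorm (hmult z (hexp FX (real i * h))) \<le> \<rho>" and \<rho>: "\<rho> < \<eta>"
    have "\<bar>fdelta (Suc m) h (\<lambda>t. f (hmult x (hmult z (hexp FX t))) - P (hmult z (hexp FX t))) 0\<bar>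
        \<le> 2 ^ Suc m * (C * \<rho> powr u)"
    proof (rule fdelta_abs_le)
      fix i assume i: "i \<le> Suc m"
      let ?z = "hmult z (hexp FX (0 + real i * h))"
      have n: "hnorm ?z \<le> \<rho>" using z[OF i] by simp
      have "\<bar>f (hmult x ?z) - P ?z\<bar> \<le> C * hnorm ?z powr u" using n \<rho> by (intro b) linarith
      also have "\<dots> \<le> C * \<rho> powr u" using n C assms(2) by (intro mult_left_mono powr_mono2) auto
      finally show "\<bar>f (hmult x ?z) - P ?z\<bar> \<le> C * \<rho> powr u" .
    qed
    then show "\<bar>fdelta (Suc m) h (\<lambda>t. f (hmult (hmult x z) (hexp FX t))) 0\<bar> \<le> 2 ^ Suc m * C * \<rho> powr u"
      unfolding fdelta_diff fdelta_hpoly[OF P assms(3)] hmult_assoc by (simp add: mult.assoc del: fdelta.simps)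
  qed
qed

section \<open>Coefficients along the integer lattice\<close>

fun lat :: "int \<times> int \<times> int \<Rightarrow> heis" where
  "lat (a, b, c) = (of_int a, of_int b, of_int c)"

declare lat.simps [simp del]

text \<open>The lattice point whose left translate of \<open>cube (1/2)\<close> contains the
  argument. The third coordinate is rounded after the twist by the first two has been added, as the
  group law requires.\<close>

definition cell :: "heis \<Rightarrow> int \<times> int \<times> int" where
  "cell = (\<lambda>(p, q, r). (round p, round q, round (r + 2 * (of_int (round p) * q - of_int (round q) * p))))"

lemma hmult_hinv_lat:
  "hmult (hinv (lat (a, b, c))) (p, q, r) = (p - of_int a, q - of_int b, r + 2 * (of_int a * q - of_int b * p) - of_int c)"
  by (simp add: lat.simps hmult_def hinv_def algebra_simps)

definition cube :: "real \<Rightarrow> heis set" where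
  "cube d = {(p, q, r). \<bar>p\<bar> \<le> d \<and> \<bar>q\<bar> \<le> d \<and> \<bar>r\<bar> \<le> d}"

lemma in_cube: "(p, q, r) \<in> cube d \<longleftrightarrow> \<bar>p\<bar> \<le> d \<and> \<bar>q\<bar> \<le> d \<and> \<bar>r\<bar> \<le> d"
  by (simp add: cube_def)

lemma cell_cube: "hmult (hinv (lat (cell x))) x \<in> cube (1/2)"
proof -
  obtain p q r where x: "x = (p, q, r)" by (cases x)
  have "\<bar>t - of_int (round t)\<bar> \<le> 1/2" for t :: real
    using of_int_round_abs_le[of t] by (simp add: abs_minus_commute)
  then show ?thesis unfolding x cell_def prod.case hmult_hinv_lat in_cube by blast
qed

lemma cell_unique:
  assumes "hmult (hinv (lat g)) x \<in> cube d" "d < 1/2"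
  shows "cell x = g"
proof -
  obtain p q r where x: "x = (p, q, r)" by (cases x)
  obtain a b c where g: "g = (a, b, c)" by (cases g)
  have r: "round t = n" if "\<bar>t - of_int n\<bar> \<le> d" for t n
    using that assms(2) by (intro round_unique') linarith
  have "round p = a" "round q = b"
    using assms(1) by (auto simp: x g hmult_hinv_lat in_cube intro!: r)
  with assms(1) show ?thesis by (auto simp: x g hmult_hinv_lat in_cube cell_def intro!: r)
qed

text \<open>Once the first two integer coordinates agree, the twists agree as well, and the third
  coordinates can be compared. Two radii are kept because \<open>lift_eq\<close> needs 5/8 and
  1/4.\<close>

lemma cell_separated:
  assumes "hmult (hinv (lat g)) x \<in> cube d" "hmult (hinv (lat g')) x \<in> cube e" "d + e < 1"
  shows "g = g'"
proof -
  obtain p q r where x: "x = (p, q, r)" by (cases x)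
  obtain a b c where g: "g = (a, b, c)" by (cases g)
  obtain a' b' c' where g': "g' = (a', b', c')" by (cases g')
  have r: "m = n" if "\<bar>t - of_int m\<bar> \<le> d" "\<bar>t - of_int n\<bar> \<le> e" for t :: real and m n
  proof -
    have "\<bar>of_int (m - n) :: real\<bar> < 1" using that assms(3) by simp
    then have "\<bar>m - n\<bar> < 1" by linarith
    then show ?thesis by simp
  qed
  have "a = a'" "b = b'"
    using assms(1,2) by (auto simp: x g g' hmult_hinv_lat in_cube intro!: r)
  with assms(1,2) show ?thesis by (auto simp: x g g' hmult_hinv_lat in_cube intro!: r)
qed

text \<open>Plays the part of a wavelet coefficient. The factor \<open>(N powr s) ^ j\<close> makes
  it bounded on C^s uniformly in \<open>j\<close> and \<open>g\<close>; \<open>\<tau>\<close> is the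
  step relative to the mesh of scale \<open>j\<close>.\<close>

definition lattice_coeff :: "real \<Rightarrow> real \<Rightarrow> nat \<Rightarrow> real \<Rightarrow> nat \<Rightarrow> int \<times> int \<times> int \<Rightarrow> (heis \<Rightarrow> real) \<Rightarrow> real" where
  "lattice_coeff s N m \<tau> j g f =
    (N powr s) ^ j * fdelta m (\<tau> / N ^ j) (\<lambda>t. f (hmult (hdil (1 / N ^ j) (lat g)) (hexp FX t))) 0"

lemma lattice_coeff_add:
  "lattice_coeff s N m \<tau> j g (\<lambda>x. f x + f' x) = lattice_coeff s N m \<tau> j g f + lattice_coeff s N m \<tau> j g f'"
  by (simp add: lattice_coeff_def fdelta_add distrib_left)

lemma lattice_coeff_diff:
  "lattice_coeff s N m \<tau> j g (\<lambda>x. f x - f' x) = lattice_coeff s N m \<tau> j g f - lattice_coeff s N m \<tau> j g f'"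
  by (simp add: lattice_coeff_def fdelta_diff right_diff_distrib)

text \<open>Of the k + 1 differences, k give h^k through derivatives and the last gives
  \<open>h powr frac s\<close>, where h \<le> \<open>N^-j\<close>.\<close>

lemma lattice_coeff_le:
  assumes ex: "nablaH_exists (replicate (nat \<lfloor>s\<rfloor>) FX) f" and H: "holder_norm s f \<le> ereal H" "H \<ge> 0"
    and s: "s > 0" and N: "N \<ge> 1" and \<tau>: "0 \<le> \<tau>" "\<tau> \<le> 1"
  shows "\<bar>lattice_coeff s N (Suc (nat \<lfloor>s\<rfloor>)) \<tau> j g f\<bar> \<le> H"
proof -
  define k where "k = nat \<lfloor>s\<rfloor>"
  define h where "h = \<tau> / N ^ j"
  have h: "0 \<le> h" "h \<le> 1 / N ^ j" using N \<tau> by (auto simp: h_def divide_right_mono)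
  define y where "y = hdil (1 / N ^ j) (lat g)"
  define u where "u i t = nablaH (replicate i FX) f (hmult y (hexp FX t))" for i t
  have ex': "nablaH_exists (replicate i FX) f" if "i \<le> k" for i
  proof -
    have "nablaH_exists (v @ w) f \<Longrightarrow> nablaH_exists w f" for v w
      by (induction v) auto
    from this[of "replicate (k - i) FX" "replicate i FX"] show ?thesis
      using ex that by (simp flip: replicate_add k_def)
  qed
  have "\<bar>fdelta (Suc k) h (u 0) 0\<bar> \<le> \<bar>h\<bar> ^ k * (H * h powr frac s)"
  proof (rule fdelta_Suc_deriv_le)
    fix i t assume "i < k"
    then have "has_fderiv FX (nablaH (replicate i FX) f) (nablaH (replicate (Suc i) FX) f)"
      using has_fderiv_nablaH[of FX "replicate i FX" f] ex'[of "Suc i"] by simp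
    from has_fderiv_flow[OF this, of y t]
    show "(u i has_real_derivative u (Suc i) t) (at t)" by (simp only: u_def[abs_def])
  next
    fix t
    have "\<bar>u k t - u k (t + h)\<bar> \<le> H * hdist (hmult y (hexp FX t)) (hmult y (hexp FX (t + h))) powr frac s"
      using H(1) unfolding holder_norm_le_iff u_def by (auto simp: k_def simp del: split_paired_All)
    also have "hdist (hmult y (hexp FX t)) (hmult y (hexp FX (t + h))) = \<bar>h\<bar>"
      unfolding hdist_left_invariant by (simp only: hexp_add[symmetric] hdist_hmult_right hnorm_hexp)
    finally show "\<bar>u k (t + h) - u k t\<bar> \<le> H * h powr frac s" using h by (simp add: abs_minus_commute)
  qed
  also have "\<bar>h\<bar> ^ k * (H * h powr frac s) \<le> H * h powr s"
  proof -
    have "s = real k + frac s" using s by (simp add: k_def frac_def)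
    then have "frac s = s - real k" by linarith
    then show ?thesis using h H(2) power_mult_powr[OF h(1), of k s] by (auto simp: mult.left_commute)
  qed
  also have "\<dots> \<le> H * (1 / N ^ j) powr s" using h s H(2) by (intro mult_left_mono powr_mono2) auto
  also have "(1 / N ^ j) powr s = 1 / (N powr s) ^ j"
    using N by (simp add: powr_divide powr_powr powr_power mult.commute flip: powr_realpow)
  finally have "\<bar>fdelta (Suc k) h (u 0) 0\<bar> * (N powr s) ^ j \<le> H"
    using N by (simp add: pos_le_divide_eq)
  then show ?thesis
    using N by (simp add: lattice_coeff_def abs_mult k_def h_def u_def[abs_def] y_def mult.commute del: fdelta.simps)
qed

lemma lattice_coeff_exponent:
  assumes c: "c > 0" "\<And>j g. \<bar>lattice_coeff s N (Suc m) \<tau> j g f\<bar> \<ge> c"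
    and N: "N > 1" and \<tau>: "\<tau> \<ge> 0" "real (Suc m) * \<tau> \<le> 1/4" and s: "0 < s" "s < real (Suc m)"
    and u: "pointwise_holder u x f"
  shows "u \<le> s"
proof (rule ccontr)
  assume "\<not> u \<le> s"
  \<comment> \<open>Capped at m + 1, so that the polynomial of the pointwise condition is
    annihilated by the difference.\<close>
  define v where "v = min u (real (Suc m))"
  have v: "s < v" "v \<le> real (Suc m)" "v > 0" using \<open>\<not> u \<le> s\<close> s by (auto simp: v_def)
  have "pointwise_holder v x f" using u v by (intro pointwise_holder_mono[OF u]) (auto simp: v_def)
  then obtain K \<eta> where K: "K > 0" "\<eta> > 0" and b:
    "\<And>z h \<rho>. (\<And>i. i \<le> Suc m \<Longrightarrow> hnorm (hmult z (hexp FX (real i * h))) \<le> \<rho>) \<Longrightarrow> \<rho> < \<eta> \<Longrightarrow>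
       \<bar>fdelta (Suc m) h (\<lambda>t. f (hmult (hmult x z) (hexp FX t))) 0\<bar> \<le> K * \<rho> powr v"
    using pointwise_holder_fdelta v by metis
  define \<theta> where "\<theta> = N powr (s - v)"
  have \<theta>: "0 \<le> \<theta>" "\<theta> < 1" using N v by (auto simp: \<theta>_def powr_less_one)
  have bound: "c \<le> K * 2 powr v * \<theta> ^ j" if j: "2 / N ^ j < \<eta>" for j
  proof -
    \<comment> \<open>\<open>w\<close> is the position of the rescaled point in its cell, and
      \<open>z\<close> leads from \<open>x\<close> to the lattice point,
      \<open>hmult x z = hdil (1 / N ^ j) (lat (cell x'))\<close>. In rescaled coordinates the nodes
      have coordinates at most 1, hence pseudo-norm at most 2.\<close>
    define x' where "x' = hdil (N ^ j) x"
    define w where "w = hmult (hinv (lat (cell x'))) x'"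
    define z where "z = hdil (1 / N ^ j) (hinv w)"
    have "N ^ j > 0" using N by simp
    then have "1 / N ^ j * N ^ j = 1" by (metis less_irrefl nonzero_eq_divide_eq)
    then have x: "x = hdil (1 / N ^ j) x'" by (simp only: x'_def hdil_hdil hdil_1)
    have y: "hmult x z = hdil (1 / N ^ j) (lat (cell x'))"
      unfolding x z_def w_def by (simp add: hinv_hmult hinv_def[of "hinv _"] hmult_hinv_cancel flip: hdil_hmult)
         (simp add: hinv_def hmult_hinv_cancel[unfolded hinv_def])
    have "\<bar>fdelta (Suc m) (\<tau> / N ^ j) (\<lambda>t. f (hmult (hmult x z) (hexp FX t))) 0\<bar> \<le> K * (2 / N ^ j) powr v"
    proof (rule b[OF _ j])
      fix i assume i: "i \<le> Suc m"
      define e where "e = real i * \<tau>"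
      have "e \<le> real (Suc m) * \<tau>" unfolding e_def using i \<tau> by (intro mult_right_mono) auto
      then have e: "0 \<le> e" "e \<le> 1/4" using \<tau> by (auto simp: e_def)
      have "hmult z (hexp FX (real i * (\<tau> / N ^ j))) = hdil (1 / N ^ j) (hmult (hinv w) (hexp FX e))"
        by (simp only: hdil_hmult z_def hdil_hexp) (simp add: e_def)
      moreover have "hnorm (hmult (hinv w) (hexp FX e)) \<le> 2 * 1"
      proof -
        obtain w1 w2 w3 where w: "w = (w1, w2, w3)" by (cases w)
        have wb: "\<bar>w1\<bar> \<le> 1/2" "\<bar>w2\<bar> \<le> 1/2" "\<bar>w3\<bar> \<le> 1/2"
          using cell_cube[of x'] unfolding w_def[symmetric] w in_cube by auto
        have "\<bar>w2 * e\<bar> \<le> 1/2 * (1/4)" unfolding abs_mult using wb e by (intro mult_mono) auto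
        then show ?thesis unfolding w hinv_def hmult_def hexp.simps uminus_Pair prod.case
          by (intro hnorm_le) (use wb e in auto)
      qed
      ultimately show "hnorm (hmult z (hexp FX (real i * (\<tau> / N ^ j)))) \<le> 2 / N ^ j"
        using N by (simp add: hnorm_hdil divide_right_mono)
    qed
    then have "c \<le> (N powr s) ^ j * (K * (2 / N ^ j) powr v)"
      using c(2)[of j "cell x'"] N unfolding y lattice_coeff_def abs_mult
      by (smt (verit, best) abs_of_nonneg mult_left_mono powr_ge_zero zero_le_power)
    also have "(2 / N ^ j) powr v = 2 powr v / (N powr v) ^ j"
      using N by (simp add: powr_divide powr_powr powr_power mult.commute flip: powr_realpow)
    also have "(N powr s) ^ j * (K * (2 powr v / (N powr v) ^ j)) = K * 2 powr v * \<theta> ^ j"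
      by (simp add: \<theta>_def powr_diff power_divide)
    finally show ?thesis .
  qed
  have "(\<lambda>j. K * 2 powr v * \<theta> ^ j) \<longlonglongrightarrow> K * 2 powr v * 0"
    using \<theta> by (intro tendsto_intros LIMSEQ_realpow_zero)
  then have "\<forall>\<^sub>F j in sequentially. K * 2 powr v * \<theta> ^ j < c" using c(1) by (intro order_tendstoD) auto
  moreover have "(\<lambda>j. 2 * (1 / N) ^ j) \<longlonglongrightarrow> 2 * 0"
    using N by (intro tendsto_intros LIMSEQ_realpow_zero) auto
  then have "\<forall>\<^sub>F j in sequentially. 2 / N ^ j < \<eta>"
    using K order_tendstoD(2)[of "\<lambda>j. 2 * (1 / N) ^ j" 0 sequentially \<eta>] by (simp add: power_one_over field_simps)
  ultimately have "\<forall>\<^sub>F j in sequentially. False"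
    by eventually_elim (use bound in force)
  then show False by simp
qed

section \<open>Smooth bumps\<close>

text \<open>Dividing by powers of t makes the family closed under differentiation up to linear
  combinations (\<open>bexp_deriv\<close>).\<close>

definition bexp :: "nat \<Rightarrow> real \<Rightarrow> real" where
  "bexp n t = (if t > 0 then exp (- 1 / t) / t ^ n else 0)"

text \<open>From y^(n + 2) / (n + 2)! \<le> exp y at y = 1/t. The square of t yields the derivative
  0 at the origin.\<close>

lemma bexp_le: "\<bar>bexp n t\<bar> \<le> fact (n + 2) * t\<^sup>2"
proof (cases "t > 0")
  case True
  define y where "y = 1 / t"
  have y: "y > 0" using True by (simp add: y_def)
  have "y ^ (n + 2) / fact (n + 2) \<le> exp y"
  proof -
    have "(\<Sum>k\<in>{n + 2}. y ^ k /\<^sub>R fact k) \<le> exp y"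
      unfolding exp_def using y by (intro sum_le_suminf summable_exp_generic) auto
    then show ?thesis by (simp add: divide_inverse mult.commute)
  qed
  then have "y ^ n * y\<^sup>2 \<le> fact (n + 2) * exp y" by (simp add: divide_le_eq power_add power2_eq_square mult_ac)
  then have "exp (- y) * y ^ n \<le> fact (n + 2) / y\<^sup>2"
    using y by (simp add: exp_minus field_simps)
  then show ?thesis using True by (simp add: bexp_def y_def power_one_over divide_inverse power_inverse)
qed (simp add: bexp_def)

lemma bexp_deriv: "(bexp n has_real_derivative bexp (n + 2) t - real n * bexp (n + 1) t) (at t)"
proof -
  consider "t > 0" | "t < 0" | "t = 0" by linarith
  then show ?thesis
  proof cases
    case 1
    have "((\<lambda>t. exp (- 1 / t) / t ^ n) has_real_derivative bexp (n + 2) t - real n * bexp (n + 1) t) (at t)"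
    proof (cases n)
      case 0
      with 1 show ?thesis
        by (auto intro!: derivative_eq_intros simp: bexp_def power2_eq_square)
    next
      case (Suc m)
      with 1 show ?thesis
        by (auto intro!: derivative_eq_intros simp: bexp_def power2_eq_square field_simps)
           (cases m; simp)
    qed
    moreover have "\<forall>\<^sub>F u in nhds t. bexp n u = exp (- 1 / u) / u ^ n"
      using eventually_nhds_in_open[of "{0<..}" t] 1 by (auto simp: bexp_def elim: eventually_mono)
    ultimately show ?thesis by (subst DERIV_cong_ev[OF refl _ refl])
  next
    case 2
    have "\<forall>\<^sub>F u in nhds t. bexp n u = 0"
      using eventually_nhds_in_open[of "{..<0}" t] 2 by (auto simp: bexp_def elim: eventually_mono)
    then show ?thesis using 2 by (subst DERIV_cong_ev[OF refl _ refl]) (auto simp: bexp_def)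
  next
    case 3
    have "((\<lambda>h. (bexp n (0 + h) - bexp n 0) / h) \<longlongrightarrow> 0) (at 0)"
    proof (rule tendsto_rabs_zero_cancel, rule tendsto_sandwich[OF _ _ tendsto_const])
      show "\<forall>\<^sub>F h in at 0. 0 \<le> \<bar>(bexp n (0 + h) - bexp n 0) / h\<bar>" by simp
      have "\<bar>(bexp n (0 + h) - bexp n 0) / h\<bar> \<le> fact (n + 2) * \<bar>h\<bar>" if "h \<noteq> 0" for h
        using bexp_le[of n h] that
        by (simp add: bexp_def abs_divide divide_le_eq power2_eq_square mult.assoc abs_mult_self_eq)
      then show "\<forall>\<^sub>F h in at 0. \<bar>(bexp n (0 + h) - bexp n 0) / h\<bar> \<le> fact (n + 2) * \<bar>h\<bar>"
        by (auto simp: eventually_at_filter)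
      have "((\<lambda>h. fact (n + 2) * \<bar>h\<bar>) \<longlongrightarrow> fact (n + 2) * \<bar>0 :: real\<bar>) (at 0)"
        by (intro tendsto_intros)
      then show "((\<lambda>h::real. fact (n + 2) * \<bar>h\<bar>) \<longlongrightarrow> 0) (at 0)" by simp
    qed
    then show ?thesis using 3 by (simp add: DERIV_def bexp_def)
  qed
qed

text \<open>Closed under the three fields (\<open>smooth_alg_fderiv\<close>), so that all iterated
  derivatives of a bump exist and are continuous by induction on its construction.\<close>

inductive_set smooth_alg :: "(heis \<Rightarrow> real) set" where
  const: "(\<lambda>x. c) \<in> smooth_alg"
| fst: "fst \<in> smooth_alg"
| snd: "(\<lambda>x. fst (snd x)) \<in> smooth_alg"
| trd: "(\<lambda>x. snd (snd x)) \<in> smooth_alg"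
| add: "F \<in> smooth_alg \<Longrightarrow> G \<in> smooth_alg \<Longrightarrow> (\<lambda>x. F x + G x) \<in> smooth_alg"
| mult: "F \<in> smooth_alg \<Longrightarrow> G \<in> smooth_alg \<Longrightarrow> (\<lambda>x. F x * G x) \<in> smooth_alg"
| bexp: "F \<in> smooth_alg \<Longrightarrow> (\<lambda>x. bexp n (F x)) \<in> smooth_alg"

lemma smooth_alg_fderiv:
  assumes "F \<in> smooth_alg"
  shows "\<exists>G\<in>smooth_alg. has_fderiv V F G"
  using assms
proof induction
  case (const c)
  show ?case by (rule bexI[OF _ smooth_alg.const[of 0]]) (simp add: has_fderiv_def)
next
  case fst
  have "has_fderiv V fst (\<lambda>x. case V of FX \<Rightarrow> 1 | FY \<Rightarrow> 0 | FZ \<Rightarrow> 0)"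
    by (cases V) (auto simp: has_fderiv_def hmult_def intro!: derivative_eq_intros)
  then show ?case using smooth_alg.const by blast
next
  case snd
  have "has_fderiv V (\<lambda>x. fst (snd x)) (\<lambda>x. case V of FX \<Rightarrow> 0 | FY \<Rightarrow> 1 | FZ \<Rightarrow> 0)"
    by (cases V) (auto simp: has_fderiv_def hmult_def intro!: derivative_eq_intros)
  then show ?case using smooth_alg.const by blast
next
  case trd
  have "has_fderiv V (\<lambda>x. snd (snd x)) (case V of FX \<Rightarrow> (\<lambda>x. 2 * fst (snd x)) | FY \<Rightarrow> (\<lambda>x. (- 2) * fst x) | FZ \<Rightarrow> (\<lambda>x. 1))"
    by (cases V) (auto simp: has_fderiv_def hmult_def intro!: derivative_eq_intros)
  moreover have "(case V of FX \<Rightarrow> (\<lambda>x. 2 * fst (snd x)) | FY \<Rightarrow> (\<lambda>x. (- 2) * fst x) | FZ \<Rightarrow> (\<lambda>x. 1)) \<in> smooth_alg"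
  proof (cases V)
    case FY
    show ?thesis unfolding FY hfield.case by (intro smooth_alg.intros)
  qed (auto intro: smooth_alg.intros)
  ultimately show ?case by blast
next
  case (add F G)
  then obtain F' G' where "F' \<in> smooth_alg" "G' \<in> smooth_alg" "has_fderiv V F F'" "has_fderiv V G G'" by blast
  then show ?case using smooth_alg.add has_fderiv_add by blast
next
  case (mult F G)
  then obtain F' G' where *: "F' \<in> smooth_alg" "G' \<in> smooth_alg" "has_fderiv V F F'" "has_fderiv V G G'" by blast
  have "has_fderiv V (\<lambda>x. F x * G x) (\<lambda>x. F' x * G x + G' x * F x)"
    unfolding has_fderiv_def
  proof
    fix x
    show "((\<lambda>t. F (hmult x (hexp V t)) * G (hmult x (hexp V t))) has_real_derivative F' x * G x + G' x * F x) (at 0)"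
      using DERIV_mult[OF has_fderiv_flow[OF *(3), of x 0] has_fderiv_flow[OF *(4), of x 0]] by simp
  qed
  moreover have "(\<lambda>x. F' x * G x + G' x * F x) \<in> smooth_alg"
    using * mult.hyps by (intro smooth_alg.add smooth_alg.mult)
  ultimately show ?case by blast
next
  case (bexp F n)
  then obtain F' where *: "F' \<in> smooth_alg" "has_fderiv V F F'" by blast
  have "has_fderiv V (\<lambda>x. bexp n (F x)) (\<lambda>x. (bexp (n + 2) (F x) + (- real n) * bexp (n + 1) (F x)) * F' x)"
    unfolding has_fderiv_def
  proof
    fix x
    show "((\<lambda>t. bexp n (F (hmult x (hexp V t)))) has_real_derivative
        (bexp (n + 2) (F x) + (- real n) * bexp (n + 1) (F x)) * F' x) (at 0)"
      using DERIV_chain2[OF bexp_deriv has_fderiv_flow[OF *(2), of x 0], of n] by simp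
  qed
  moreover have "(\<lambda>x. (bexp (n + 2) (F x) + (- real n) * bexp (n + 1) (F x)) * F' x) \<in> smooth_alg"
    using * bexp.hyps by (intro smooth_alg.add smooth_alg.mult smooth_alg.bexp smooth_alg.const)
  ultimately show ?case by blast
qed

lemma smooth_alg_continuous:
  assumes "F \<in> smooth_alg"
  shows "continuous_on UNIV F"
  using assms
proof induction
  case (bexp F n)
  have "continuous_on UNIV (bexp n)"
    by (intro continuous_at_imp_continuous_on ballI DERIV_isCont[OF bexp_deriv])
  then show ?case using bexp by (auto intro: continuous_on_compose2)
qed (auto intro!: continuous_intros)

lemma smooth_alg_nablaH: "F \<in> smooth_alg \<Longrightarrow> nablaH w F \<in> smooth_alg \<and> nablaH_exists w F"
proof (induction w)
  case (Cons V w)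
  then obtain G where "G \<in> smooth_alg" "has_fderiv V (nablaH w F) G"
    using smooth_alg_fderiv by blast
  with Cons show ?case by (simp add: has_fderivD)
qed simp

lemma smooth_bump_exists:
  assumes "d > 0"
  obtains \<phi> where "\<phi> \<in> smooth_alg" "\<phi> 0 = 1" "\<And>p q r. d \<le> \<bar>p\<bar> \<or> d \<le> \<bar>q\<bar> \<or> d \<le> \<bar>r\<bar> \<Longrightarrow> \<phi> (p, q, r) = 0"
proof
  \<comment> \<open>Positive exactly for \<bar>F x\<bar> < d. The minus sign is written as a factor
    because the algebra is generated by sums and products.\<close>
  define b where "b F x = bexp 0 (d + F x) * bexp 0 (d + (- 1) * F x)" for F :: "heis \<Rightarrow> real" and x
  define \<psi> where "\<psi> x = b fst x * (b (\<lambda>x. fst (snd x)) x * b (\<lambda>x. snd (snd x)) x)" for x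
  define \<phi> where "\<phi> x = (1 / \<psi> 0) * \<psi> x" for x
  have b: "b F \<in> smooth_alg" if "F \<in> smooth_alg" for F
    unfolding b_def[abs_def]
    by (intro smooth_alg.mult smooth_alg.bexp smooth_alg.add smooth_alg.const that)
  then show "\<phi> \<in> smooth_alg"
    unfolding \<phi>_def[abs_def] \<psi>_def[abs_def] by (intro smooth_alg.mult smooth_alg.const b smooth_alg.fst smooth_alg.snd smooth_alg.trd)
  have "bexp 0 d > 0" using assms by (simp add: bexp_def)
  then have "\<psi> 0 \<noteq> 0" by (simp add: \<psi>_def b_def zero_prod_def)
  then show "\<phi> 0 = 1" by (simp add: \<phi>_def)
  show "\<phi> (p, q, r) = 0" if "d \<le> \<bar>p\<bar> \<or> d \<le> \<bar>q\<bar> \<or> d \<le> \<bar>r\<bar>" for p q r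
    using that proof -
    have "b F x = 0" if "d \<le> \<bar>F x\<bar>" for F x
      using that by (cases "F x \<ge> 0") (simp_all add: b_def bexp_def)
    then show ?thesis using that by (auto simp: \<phi>_def \<psi>_def)
  qed
qed

section \<open>Continuity of the group operations and supports of derivatives\<close>

lemma continuous_on_hmult [continuous_intros]:
  assumes "continuous_on S f" "continuous_on S g"
  shows "continuous_on S (\<lambda>x. hmult (f x) (g x))"
proof -
  have "hmult x y = (fst x + fst y, fst (snd x) + fst (snd y),
     snd (snd x) + snd (snd y) + 2 * (fst (snd x) * fst y - fst x * fst (snd y)))" for x y
    by (simp add: hmult_def case_prod_beta)
  then show ?thesis using assms by (auto intro!: continuous_intros)
qed

lemma continuous_on_hdil [continuous_intros]:
  assumes "continuous_on S f"
  shows "continuous_on S (\<lambda>x. hdil l (f x))"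
proof -
  have "hdil l x = (l * fst x, l * fst (snd x), l\<^sup>2 * snd (snd x))" for x
    by (simp add: hdil_def case_prod_beta)
  then show ?thesis using assms by (auto intro!: continuous_intros)
qed

lemma continuous_on_hexp [continuous_intros]:
  assumes "continuous_on S f"
  shows "continuous_on S (\<lambda>x. hexp V (f x))"
  using assms by (cases V) (auto intro!: continuous_intros)

lemma compact_cube: "compact (cube d)"
proof -
  have "cube d = cbox (- d, - d, - d) (d, d, d)"
    by (auto simp: cube_def cbox_Pair_eq abs_le_iff)
  then show ?thesis by simp
qed

lemma has_fderiv_vanish:
  assumes "has_fderiv V F G" "closed K" "\<And>x. x \<notin> K \<Longrightarrow> F x = 0" "x \<notin> K"
  shows "G x = 0"
proof -
  have "open ((\<lambda>t. hmult x (hexp V t)) -` (- K))"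
    using assms(2) by (intro open_vimage continuous_intros) auto
  then have "\<forall>\<^sub>F t in nhds 0. t \<in> (\<lambda>t. hmult x (hexp V t)) -` (- K)"
    using assms(4) by (intro eventually_nhds_in_open) auto
  then have "\<forall>\<^sub>F t in nhds 0. F (hmult x (hexp V t)) = 0"
    by eventually_elim (use assms(3) in auto)
  moreover have "((\<lambda>t. F (hmult x (hexp V t))) has_real_derivative G x) (at 0)"
    using has_fderiv_flow[OF assms(1), of x 0] by simp
  ultimately have "((\<lambda>t. 0) has_real_derivative G x) (at 0)"
    by (subst (asm) DERIV_cong_ev[OF refl _ refl])
  then show ?thesis using DERIV_unique DERIV_const by blast
qed

lemma nablaH_vanish:
  assumes "F \<in> smooth_alg" "closed K" "\<And>x. x \<notin> K \<Longrightarrow> F x = 0" "x \<notin> K"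
  shows "nablaH w F x = 0"
  using assms(4)
proof (induction w arbitrary: x)
  case (Cons V w)
  have "has_fderiv V (nablaH w F) (nablaH (V # w) F)"
    using smooth_alg_nablaH[OF assms(1), of "V # w"] by (intro has_fderiv_nablaH) auto
  from has_fderiv_vanish[OF this assms(2) Cons.IH Cons.prems] show ?case .
qed (use assms in auto)

section \<open>Lattice sums of bumps\<close>

text \<open>For F supported in \<open>cube (1/4)\<close> this is the sum over all lattice points g
  of \<theta>(g) F(g^-1 * x): at most the term of the cell of x is nonzero.\<close>

definition lift :: "(int \<times> int \<times> int \<Rightarrow> real) \<Rightarrow> (heis \<Rightarrow> real) \<Rightarrow> heis \<Rightarrow> real" where
  "lift \<theta> F x = \<theta> (cell x) * F (hmult (hinv (lat (cell x))) x)"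

text \<open>\<open>cell\<close> jumps at cell boundaries, but on the larger cube around
  \<open>g\<close> the formula with fixed \<open>g\<close> persists: a point of it in the support
  around another lattice point is excluded by 5/8 + 1/4 < 1. Hence \<open>lift\<close> is locally
  one translate of F and inherits its regularity.\<close>

lemma lift_eq:
  assumes F: "{x. F x \<noteq> 0} \<subseteq> cube (1/4)" and x: "hmult (hinv (lat g)) x \<in> cube (5/8)"
  shows "lift \<theta> F x = \<theta> g * F (hmult (hinv (lat g)) x)"
proof (cases "cell x = g")
  case False
  have "hmult (hinv (lat g)) x \<notin> cube (1/4)"
    using False cell_unique[of g x "1/4"] by auto
  moreover have "hmult (hinv (lat (cell x))) x \<notin> cube (1/4)"
    using False cell_separated[OF x, of "cell x" "1/4"] by auto
  ultimately have "F (hmult (hinv (lat g)) x) = 0" "F (hmult (hinv (lat (cell x))) x) = 0"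
    using F by blast+
  then show ?thesis by (simp add: lift_def)
qed (simp add: lift_def)

lemma lift_local:
  assumes F: "{x. F x \<noteq> 0} \<subseteq> cube (1/4)"
  shows "\<forall>\<^sub>F y in nhds x. lift \<theta> F (hdil l y) =
    \<theta> (cell (hdil l x)) * F (hmult (hinv (lat (cell (hdil l x)))) (hdil l y))"
proof -
  let ?g = "cell (hdil l x)"
  \<comment> \<open>An open box between the closed cell and the cube where \<open>lift_eq\<close>
    applies.\<close>
  let ?O = "{-5/8<..<5/8} \<times> {-5/8<..<5/8} \<times> {-5/8<..<5/8} :: heis set"
  have sub: "cube (1/2) \<subseteq> ?O" "?O \<subseteq> cube (5/8)" by (auto simp: cube_def)
  have "open ((\<lambda>y. hmult (hinv (lat ?g)) (hdil l y)) -` ?O)"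
    by (intro open_vimage continuous_intros open_Times)
  then have "\<forall>\<^sub>F y in nhds x. y \<in> (\<lambda>y. hmult (hinv (lat ?g)) (hdil l y)) -` ?O"
    using cell_cube[of "hdil l x"] sub(1) by (intro eventually_nhds_in_open) auto
  then show ?thesis
  proof eventually_elim
    case (elim y)
    then have "hmult (hinv (lat ?g)) (hdil l y) \<in> cube (5/8)" by (rule subsetD[OF sub(2) vimageD])
    then show ?case by (rule lift_eq[OF F])
  qed
qed

lemma continuous_on_lift:
  assumes F: "{x. F x \<noteq> 0} \<subseteq> cube (1/4)" and c: "continuous_on UNIV F"
  shows "continuous_on UNIV (\<lambda>x. lift \<theta> F (hdil l x))"
proof (intro continuous_at_imp_continuous_on ballI)
  fix x
  let ?g = "cell (hdil l x)"
  have "continuous_on UNIV (\<lambda>y. hmult (hinv (lat ?g)) (hdil l y))"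
    by (intro continuous_intros)
  then have "continuous_on UNIV (\<lambda>y. \<theta> ?g * F (hmult (hinv (lat ?g)) (hdil l y)))"
    by (intro continuous_on_mult_left continuous_on_compose2[OF c _ subset_UNIV])
  then have "isCont (\<lambda>y. \<theta> ?g * F (hmult (hinv (lat ?g)) (hdil l y))) x"
    using continuous_on_eq_continuous_at[OF open_UNIV] by blast
  then show "isCont (\<lambda>x. lift \<theta> F (hdil l x)) x"
    using isCont_cong[OF lift_local[OF F, of \<theta> l x]] by blast
qed

lemma has_fderiv_lift:
  assumes F: "{x. F x \<noteq> 0} \<subseteq> cube (1/4)" and FG: "has_fderiv V F G"
  shows "has_fderiv V (\<lambda>x. lift \<theta> F (hdil l x)) (\<lambda>x. l ^ fweight V * lift \<theta> G (hdil l x))"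
  unfolding has_fderiv_def
proof
  fix x
  let ?g = "cell (hdil l x)"
  define z where "z = hmult (hinv (lat ?g)) (hdil l x)"
  have "isCont (\<lambda>t. hmult x (hexp V t)) 0"
    using continuous_on_eq_continuous_at[of UNIV "\<lambda>t. hmult x (hexp V t)"] by (auto intro!: continuous_intros)
  then have "((\<lambda>t. hmult x (hexp V t)) \<longlongrightarrow> hmult x (hexp V 0)) (nhds 0)"
    unfolding isCont_def by (rule tendsto_at_iff_tendsto_nhds[THEN iffD1])
  then have "filterlim (\<lambda>t. hmult x (hexp V t)) (nhds x) (nhds 0)" by simp
  from eventually_compose_filterlim[OF lift_local[OF F, of \<theta> l x] this]
  have "\<forall>\<^sub>F t in nhds 0. lift \<theta> F (hdil l (hmult x (hexp V t))) = \<theta> ?g * F (hmult z (hexp V (l ^ fweight V * t)))"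
    unfolding hdil_hmult hdil_hexp z_def hmult_assoc by simp
  moreover have "((\<lambda>t. \<theta> ?g * F (hmult z (hexp V (l ^ fweight V * t)))) has_real_derivative
      \<theta> ?g * (G (hmult z (hexp V (l ^ fweight V * 0))) * l ^ fweight V)) (at 0)"
    by (intro DERIV_cmult DERIV_chain2[OF has_fderiv_flow[OF FG]]) (auto intro!: derivative_eq_intros)
  ultimately show "((\<lambda>t. lift \<theta> F (hdil l (hmult x (hexp V t)))) has_real_derivative
      l ^ fweight V * lift \<theta> G (hdil l x)) (at 0)"
    by (subst DERIV_cong_ev[OF refl _ refl]) (auto simp: lift_def z_def mult_ac)
qed

text \<open>With truncated subtraction, (i - J) + (J - i) is the distance of i and J.\<close>

lemma geometric_two_sided_sums:
  fixes \<rho> :: real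
  assumes "0 < \<rho>" "\<rho> < 1"
  obtains S where "(\<lambda>i. \<rho> ^ ((i - J) + (J - i))) sums S" "S \<le> 1 + 2 * \<rho> / (1 - \<rho>)"
proof -
  let ?f = "\<lambda>i. \<rho> ^ ((i - J) + (J - i))"
  have geo: "(\<lambda>i. \<rho> ^ i) sums (1 / (1 - \<rho>))" using assms by (intro geometric_sums) auto
  then have "(\<lambda>i. ?f (i + J)) sums (1 / (1 - \<rho>))" by simp
  then have "?f sums (1 / (1 - \<rho>) + (\<Sum>i<J. ?f i))" by (rule sums_iff_shift[THEN iffD1])
  moreover have "(\<Sum>i<J. ?f i) = \<rho> * (\<Sum>i<J. \<rho> ^ i)"
  proof -
    have "(\<Sum>i<J. ?f i) = (\<Sum>i<J. \<rho> ^ (Suc (J - Suc i)))"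
      by (intro sum.cong) (auto simp: Suc_diff_Suc)
    also have "\<dots> = (\<Sum>i<J. \<rho> ^ Suc i)" by (rule sum.nat_diff_reindex)
    finally show ?thesis by (simp add: sum_distrib_left)
  qed
  moreover have "(\<Sum>i<J. \<rho> ^ i) \<le> 1 / (1 - \<rho>)"
    unfolding sums_unique[OF geo] using assms
    by (intro sum_le_suminf sums_summable[OF geo]) auto
  then have "\<rho> * (\<Sum>i<J. \<rho> ^ i) \<le> \<rho> * (1 / (1 - \<rho>))" using assms by (intro mult_left_mono) auto
  moreover have "1 / (1 - \<rho>) + \<rho> * (1 / (1 - \<rho>)) = 1 + 2 * \<rho> / (1 - \<rho>)" using assms by (simp add: field_simps)
  ultimately show ?thesis by (intro that[of "1 / (1 - \<rho>) + (\<Sum>i<J. ?f i)"]) simp_all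
qed

text \<open>Measures how far one scale dominates: the bound for all other terms tends to 0 with
  \<open>\<rho>\<close>.\<close>

lemma suminf_two_sided_le:
  fixes a :: "nat \<Rightarrow> real"
  assumes \<rho>: "0 < \<rho>" "\<rho> < 1" and C: "C \<ge> 0"
    and a: "\<And>i. i \<noteq> J \<Longrightarrow> \<bar>a i\<bar> \<le> C * \<rho> ^ ((i - J) + (J - i))"
  shows "\<bar>(\<Sum>i. a i) - a J\<bar> \<le> C * (2 * \<rho> / (1 - \<rho>))"
proof -
  obtain S where S: "(\<lambda>i. \<rho> ^ ((i - J) + (J - i))) sums S" "S \<le> 1 + 2 * \<rho> / (1 - \<rho>)"
    using geometric_two_sided_sums[OF \<rho>] by blast
  let ?d = "\<lambda>c i. if i = J then c else (0 :: real)"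
  have dom: "(\<lambda>i. C * (\<rho> ^ ((i - J) + (J - i)) - ?d 1 i)) sums (C * (S - 1))"
    by (intro sums_mult sums_diff S(1) sums_single)
  have le: "norm (a i - ?d (a J) i) \<le> C * (\<rho> ^ ((i - J) + (J - i)) - ?d 1 i)" for i
    using a[of i] by auto
  have *: "norm (\<Sum>i. a i - ?d (a J) i) \<le> C * (S - 1)"
    unfolding sums_unique[OF dom] by (rule norm_suminf_le[OF le sums_summable[OF dom]])
  have sm: "summable (\<lambda>i. a i - ?d (a J) i)"
    by (rule summable_comparison_test'[OF sums_summable[OF dom] le])
  have "summable (\<lambda>i. (a i - ?d (a J) i) + ?d (a J) i)"
    by (intro summable_add sm sums_summable[OF sums_single])
  then have "summable a" by simp
  then have "(\<Sum>i. a i - ?d (a J) i) = (\<Sum>i. a i) - a J"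
    using suminf_diff[OF _ sums_summable[OF sums_single[of J "\<lambda>_. a J"]], of a] sums_unique[OF sums_single[of J "\<lambda>_. a J"]] by simp
  moreover have "C * (S - 1) \<le> C * (2 * \<rho> / (1 - \<rho>))" using S(2) C by (intro mult_left_mono) auto
  ultimately show ?thesis using * by simp
qed

lemma finite_bounded_mweight: "finite {w. mweight w \<le> n}"
proof (rule finite_subset)
  have "length w \<le> mweight w" for w
  proof (induction w)
    case (Cons V w)
    then show ?case by (cases V) auto
  qed simp
  then show "{w. mweight w \<le> n} \<subseteq> {w. set w \<subseteq> {FX, FY, FZ} \<and> length w \<le> n}"
    by (auto intro: order.trans) (metis hfield.exhaust)
qed (rule finite_lists_length_le, simp)

lemma nonneg_not_Nats_imp_not_Ints:
  fixes s :: real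
  assumes "s \<ge> 0" "s \<notin> \<nat>"
  shows "s \<notin> \<int>"
proof
  assume "s \<in> \<int>"
  then obtain n where n: "s = of_int n" by (rule Ints_cases)
  then have "s = real (nat n)" using assms(1) by simp
  then show False using assms(2) by (metis of_nat_in_Nats)
qed

text \<open>
  \<open>series \<theta> w\<close> is the derivative of index \<open>w\<close> of
  \<open>\<Sum>\<^sub>j N\<^bsup>-js\<^esup> \<Sum>\<^sub>g \<theta>\<^sub>j(g) \<phi>(g\<^sup>-\<^sup>1 * (N\<^sup>j \<circ> x))\<close>, \<open>g\<close> running over
  the integer lattice; the supports of the inner terms are disjoint.
\<close>

locale bump_series =
  fixes \<phi> :: "heis \<Rightarrow> real" and s N M :: real and k :: nat
  assumes \<phi>: "\<phi> \<in> smooth_alg" "{x. \<phi> x \<noteq> 0} \<subseteq> cube (1/4)"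
    and s: "s > 0" "s \<notin> \<nat>" and k: "k = nat \<lfloor>s\<rfloor>" and N: "N > 1"
    and M: "\<And>w x. mweight w \<le> Suc k \<Longrightarrow> \<bar>nablaH w \<phi> x\<bar> \<le> M"
begin

definition summand :: "(nat \<Rightarrow> int \<times> int \<times> int \<Rightarrow> real) \<Rightarrow> hfield list \<Rightarrow> nat \<Rightarrow> heis \<Rightarrow> real" where
  "summand \<theta> w j x = (N powr - s) ^ j * (N ^ j) ^ mweight w * lift (\<theta> j) (nablaH w \<phi>) (hdil (N ^ j) x)"

definition series :: "(nat \<Rightarrow> int \<times> int \<times> int \<Rightarrow> real) \<Rightarrow> hfield list \<Rightarrow> heis \<Rightarrow> real" where
  "series \<theta> w x = (\<Sum>j. summand \<theta> w j x)"

text \<open>A common decay rate per scale: finer scales lose at least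
  \<open>N powr - frac s\<close>, coarser ones \<open>N powr - (1 - frac s)\<close>.\<close>

definition \<rho> :: real where
  "\<rho> = N powr - min (frac s) (1 - frac s)"

lemma frac: "0 < frac s" "frac s < 1" "s = real k + frac s"
proof -
  show "0 < frac s" using nonneg_not_Nats_imp_not_Ints s by (simp add: frac_gt_0_iff)
  show "s = real k + frac s" using s by (simp add: k frac_def)
qed (rule frac_lt_1)

lemma \<rho>: "0 < \<rho>" "\<rho> < 1"
  using N frac by (auto simp: \<rho>_def powr_less_one min_def)

lemma powr_le_\<rho>: "frac s \<le> t \<or> 1 - frac s \<le> t \<Longrightarrow> N powr - t \<le> \<rho>"
  unfolding \<rho>_def using N by (intro powr_mono) auto

lemma M0: "M \<ge> 0"
  using M[of "[]" 0] by simp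

lemma nablaH_\<phi>_support: "{x. nablaH w \<phi> x \<noteq> 0} \<subseteq> cube (1/4)"
proof -
  have "\<phi> x = 0" if "x \<notin> cube (1/4)" for x using that \<phi>(2) by blast
  from nablaH_vanish[OF \<phi>(1) compact_imp_closed[OF compact_cube] this, of "1/4"]
  show ?thesis by blast
qed

context
  fixes \<theta> :: "nat \<Rightarrow> int \<times> int \<times> int \<Rightarrow> real" and \<epsilon> :: real
  assumes \<theta>: "\<And>j g. \<bar>\<theta> j g\<bar> \<le> \<epsilon>"
begin

lemma \<epsilon>0: "\<epsilon> \<ge> 0"
  using \<theta>[of 0 undefined] by linarith

lemma coeff_powr: "(N powr - s) ^ j * (N ^ j) ^ n = (N powr (real n - s)) ^ j"
proof -
  have "(N ^ j) ^ n = (N powr n) ^ j" using N by (simp add: powr_realpow mult.commute flip: power_mult)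
  then show ?thesis by (simp add: powr_add[symmetric] flip: power_mult_distrib)
qed

lemma lift_bound:
  assumes "mweight w \<le> Suc k"
  shows "\<bar>lift (\<theta> j) (nablaH w \<phi>) x\<bar> \<le> \<epsilon> * M"
  unfolding lift_def abs_mult by (intro mult_mono \<theta> M assms) (auto simp: \<epsilon>0)

lemma summand_bound:
  assumes "mweight w \<le> Suc k"
  shows "\<bar>summand \<theta> w j x\<bar> \<le> (\<epsilon> * M) * (N powr (mweight w - s)) ^ j"
  unfolding summand_def coeff_powr abs_mult using N
  by (subst mult.commute, intro mult_mono lift_bound assms) (auto simp: \<epsilon>0 M0)

lemma summand_bound_summable:
  assumes "mweight w \<le> k"
  shows "summable (\<lambda>j. (\<epsilon> * M) * (N powr (mweight w - s)) ^ j)"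
proof -
  have "real (mweight w) \<le> real k" using assms by simp
  then have "real (mweight w) - s < 0" using frac by linarith
  then show ?thesis using N by (intro summable_mult summable_geometric) (auto simp: powr_less_one)
qed

lemma summand_summable:
  assumes "mweight w \<le> k"
  shows "summable (\<lambda>j. summand \<theta> w j x)"
  by (rule summable_comparison_test'[OF summand_bound_summable[OF assms]]) (use assms in \<open>auto intro!: summand_bound\<close>)

lemma summand_continuous: "continuous_on UNIV (summand \<theta> w j)"
proof -
  have "continuous_on UNIV (\<lambda>x. lift (\<theta> j) (nablaH w \<phi>) (hdil (N ^ j) x))"
    using smooth_alg_nablaH[OF \<phi>(1)] by (intro continuous_on_lift nablaH_\<phi>_support smooth_alg_continuous) auto
  then show ?thesis unfolding summand_def[abs_def] by (intro continuous_on_mult_left)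
qed

lemma series_continuous:
  assumes "mweight w \<le> k"
  shows "continuous_on UNIV (series \<theta> w)"
proof -
  have "uniform_limit UNIV (\<lambda>n x. \<Sum>j<n. summand \<theta> w j x) (\<lambda>x. \<Sum>j. summand \<theta> w j x) sequentially"
    by (rule Weierstrass_m_test[OF _ summand_bound_summable[OF assms]]) (use assms in \<open>auto intro!: summand_bound\<close>)
  then have "continuous_on UNIV (\<lambda>x. \<Sum>j. summand \<theta> w j x)"
    by (rule uniform_limit_theorem[rotated]) (auto intro!: always_eventually continuous_on_sum summand_continuous)
  then show ?thesis by (simp add: series_def[abs_def])
qed

lemma summand_fderiv: "has_fderiv V (summand \<theta> w j) (summand \<theta> (V # w) j)"
proof -
  have "has_fderiv V (nablaH w \<phi>) (nablaH (V # w) \<phi>)"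
    using smooth_alg_nablaH[OF \<phi>(1), of "V # w"] by (intro has_fderiv_nablaH) auto
  from has_fderiv_lift[OF nablaH_\<phi>_support this, of "\<theta> j" "N ^ j"]
  have *: "has_fderiv V (\<lambda>x. lift (\<theta> j) (nablaH w \<phi>) (hdil (N ^ j) x))
    (\<lambda>x. (N ^ j) ^ fweight V * lift (\<theta> j) (nablaH (V # w) \<phi>) (hdil (N ^ j) x))" .
  show ?thesis
    unfolding has_fderiv_def
  proof
    fix x
    show "((\<lambda>t. summand \<theta> w j (hmult x (hexp V t))) has_real_derivative summand \<theta> (V # w) j x) (at 0)"
      using DERIV_cmult[OF has_fderiv_flow[OF *, of x 0], of "(N powr - s) ^ j * (N ^ j) ^ mweight w"]
      by (simp add: summand_def power_add mult_ac del: nablaH.simps)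
  qed
qed

lemma series_fderiv:
  assumes "mweight (V # w) \<le> k"
  shows "has_fderiv V (series \<theta> w) (series \<theta> (V # w))"
  unfolding has_fderiv_def
proof
  fix x
  have w: "mweight w \<le> k" using assms by simp
  have "((\<lambda>t. \<Sum>j. summand \<theta> w j (hmult x (hexp V t))) has_real_derivative
      (\<Sum>j. summand \<theta> (V # w) j (hmult x (hexp V 0)))) (at 0)"
  proof (rule has_field_derivative_series'(2)[where S = UNIV and f = "\<lambda>j t. summand \<theta> w j (hmult x (hexp V t))"
        and f' = "\<lambda>j t. summand \<theta> (V # w) j (hmult x (hexp V t))" and x = 0])
    show "((\<lambda>t. summand \<theta> w n (hmult x (hexp V t))) has_field_derivative summand \<theta> (V # w) n (hmult x (hexp V t)))
        (at t within UNIV)" for n t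
      by (rule has_fderiv_flow[OF summand_fderiv])
    show "uniformly_convergent_on UNIV (\<lambda>n t. \<Sum>i<n. summand \<theta> (V # w) i (hmult x (hexp V t)))"
      by (rule Weierstrass_m_test'[OF _ summand_bound_summable[OF assms]])
         (use assms in \<open>auto intro!: summand_bound simp del: mweight_simps\<close>)
    show "summable (\<lambda>n. summand \<theta> w n (hmult x (hexp V t)))" for t by (rule summand_summable[OF w])
  qed auto
  then show "((\<lambda>t. series \<theta> w (hmult x (hexp V t))) has_real_derivative series \<theta> (V # w) x) (at 0)"
    by (simp add: series_def)
qed

lemma nablaH_series:
  "mweight w \<le> k \<Longrightarrow> nablaH_exists w (series \<theta> []) \<and> nablaH w (series \<theta> []) = series \<theta> w"
proof (induction w)
  case (Cons V w)
  then show ?case using series_fderiv[OF Cons.prems] by (simp add: has_fderivD)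
qed simp

text \<open>Each summand is differentiated once more than the series; hence the locale bounds
  derivatives of the bump up to weight k + 1.\<close>

lemma summand_lipschitz:
  assumes "mweight w = k"
  shows "\<bar>summand \<theta> w j x - summand \<theta> w j y\<bar> \<le> 6 * (\<epsilon> * M) * (N powr - frac s) ^ j * (N ^ j * hdist x y)"
proof -
  have e: "real (mweight w) - s = - frac s" using frac assms by simp
  have "\<bar>summand \<theta> (V # w) j z\<bar> \<le> (\<epsilon> * M) * (N powr - frac s) ^ j * N ^ j" if "fweight V = 1" for V z
  proof -
    have "\<bar>summand \<theta> (V # w) j z\<bar> \<le> (\<epsilon> * M) * (N powr (mweight (V # w) - s)) ^ j"
      by (rule summand_bound) (use assms that in simp)
    also have "N powr (real (mweight (V # w)) - s) = N powr (- frac s + 1)"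
    proof -
      have "real (mweight (V # w)) - s = - frac s + 1" using e that by simp
      then show ?thesis by (rule arg_cong)
    qed
    also have "\<dots> = N powr - frac s * N" using N by (simp only: powr_add) simp
    finally show ?thesis by (simp add: power_mult_distrib mult_ac)
  qed
  then have "\<bar>summand \<theta> w j x - summand \<theta> w j y\<bar> \<le> 6 * ((\<epsilon> * M) * (N powr - frac s) ^ j * N ^ j) * hdist x y"
    by (intro horizontal_lipschitz[OF summand_fderiv summand_fderiv]) auto
  then show ?thesis by (simp add: mult_ac)
qed

lemma series_holder:
  assumes w: "mweight w = k"
  shows "\<bar>series \<theta> w x - series \<theta> w y\<bar> \<le> \<epsilon> * (6 * M / \<rho> * (1 + 2 * \<rho> / (1 - \<rho>))) * hdist x y powr frac s"
proof (cases "x = y")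
  case False
  define d where "d = hdist x y"
  define \<sigma> where "\<sigma> = frac s"
  have \<sigma>: "0 < \<sigma>" "\<sigma> < 1" using frac by (auto simp: \<sigma>_def)
  have d: "d > 0" using False by (simp add: d_def hdist_pos)
  have "\<exists>n. 1 / d < N ^ n" using N by (rule real_arch_pow)
  \<comment> \<open>The critical scale: the first with \<open>N^n\<close> > 1/d. From
    \<open>n\<close> on, the sup bound is used, below it the Lipschitz bound; both decay
    geometrically away from \<open>n\<close>.\<close>
  then obtain n where n: "1 / d < N ^ n" "\<And>i. i < n \<Longrightarrow> \<not> 1 / d < N ^ i"
    using exists_least_iff[of "\<lambda>n. 1 / d < N ^ n"] by blast
  define r where "r = N powr - \<sigma>"
  have r: "0 < r" "r \<le> \<rho>" using N powr_le_\<rho>[of \<sigma>] by (auto simp: r_def \<sigma>_def)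
  have r_pow: "r ^ i = (N ^ i) powr - \<sigma>" for i
    using N by (simp add: r_def powr_powr powr_power mult.commute flip: powr_realpow)
  define a where "a i = summand \<theta> w i x - summand \<theta> w i y" for i
  \<comment> \<open>The factor 1/\<open>\<rho>\<close> pays for the coarse scales, where minimality
    of \<open>n\<close> only gives \<open>N^(n - 1) * d \<le> 1\<close>.\<close>
  define C where "C = 6 * (\<epsilon> * M) * d powr \<sigma> / \<rho>"
  have C: "C \<ge> 0" using \<rho> \<epsilon>0 M0 by (simp add: C_def)
  have a: "\<bar>a i\<bar> \<le> C * \<rho> ^ ((i - n) + (n - i))" for i
  proof (cases "n \<le> i")
    case True
    have "real (mweight w) - s = - \<sigma>" using frac w by (simp add: \<sigma>_def)
    then have "\<bar>a i\<bar> \<le> 2 * (\<epsilon> * M) * r ^ i"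
      using summand_bound[of w i x] summand_bound[of w i y] w unfolding a_def r_def by simp
    also have "r ^ i = r ^ n * r ^ (i - n)" using True by (simp flip: power_add)
    also have "2 * (\<epsilon> * M) * (r ^ n * r ^ (i - n)) \<le> 2 * (\<epsilon> * M) * (d powr \<sigma> * \<rho> ^ (i - n))"
    proof (intro mult_left_mono mult_mono power_mono r)
      have "(1 / d) powr \<sigma> \<le> (N ^ n) powr \<sigma>" using n(1) d \<sigma> by (intro powr_mono2) auto
      then show "r ^ n \<le> d powr \<sigma>"
        unfolding r_pow using d N by (simp add: powr_minus powr_divide field_simps)
    qed (use r \<epsilon>0 M0 in auto)
    also have "\<dots> \<le> (2 * (\<epsilon> * M) * (d powr \<sigma> * \<rho> ^ (i - n))) * (3 / \<rho>)"
    proof -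
      have "1 \<le> 3 / \<rho>" using \<rho> by simp
      moreover have "0 \<le> 2 * (\<epsilon> * M) * (d powr \<sigma> * \<rho> ^ (i - n))" using \<rho> \<epsilon>0 M0 by simp
      ultimately show ?thesis by (metis mult.right_neutral mult_left_mono)
    qed
    finally show ?thesis using True by (simp add: C_def mult_ac)
  next
    case False
    then have i: "i < n" "i \<le> n - 1" by auto
    have "\<bar>a i\<bar> \<le> 6 * (\<epsilon> * M) * (r ^ i * (N ^ i * d))"
      using summand_lipschitz[OF w, of i x y] by (simp add: a_def r_def \<sigma>_def d_def mult_ac)
    also have "r ^ i * (N ^ i * d) = (N ^ i * d) powr (1 - \<sigma>) * d powr \<sigma>"
      using N d by (simp add: r_pow powr_mult powr_diff powr_minus field_simps)
    also have "6 * (\<epsilon> * M) * \<dots> \<le> 6 * (\<epsilon> * M) * (\<rho> ^ (n - 1 - i) * d powr \<sigma>)"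
    proof (intro mult_left_mono mult_right_mono)
      have "N ^ (n - 1) * d \<le> 1" using n(2)[of "n - 1"] i d by (simp add: not_less field_simps)
      moreover have "N ^ (n - 1) = N ^ i * N ^ (n - 1 - i)" using i by (simp flip: power_add)
      ultimately have "N ^ i * d \<le> 1 / N ^ (n - 1 - i)" using N by (simp add: field_simps)
      then have "(N ^ i * d) powr (1 - \<sigma>) \<le> (1 / N ^ (n - 1 - i)) powr (1 - \<sigma>)"
        using N d \<sigma> by (intro powr_mono2) auto
      also have "\<dots> = (N powr - (1 - \<sigma>)) ^ (n - 1 - i)"
      proof -
        have "(1 / N ^ m) powr t = (N powr - t) ^ m" for m t
          using N by (simp add: powr_divide powr_powr powr_power powr_minus_divide power_one_over mult.commute power_divide flip: powr_realpow)
        then show ?thesis by blast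
      qed
      also have "\<dots> \<le> \<rho> ^ (n - 1 - i)" using powr_le_\<rho>[of "1 - \<sigma>"] by (intro power_mono) (auto simp: \<sigma>_def)
      finally show "(N ^ i * d) powr (1 - \<sigma>) \<le> \<rho> ^ (n - 1 - i)" .
    qed (use \<epsilon>0 M0 in auto)
    also have "\<rho> ^ (n - 1 - i) = \<rho> ^ (n - i) / \<rho>"
    proof -
      have "n - i = Suc (n - 1 - i)" using i by simp
      then show ?thesis using \<rho> by simp
    qed
    finally show ?thesis using i by (simp add: C_def mult_ac)
  qed
  obtain S where S: "(\<lambda>i. \<rho> ^ ((i - n) + (n - i))) sums S" "S \<le> 1 + 2 * \<rho> / (1 - \<rho>)"
    using geometric_two_sided_sums[OF \<rho>] by blast
  have dom: "(\<lambda>i. C * \<rho> ^ ((i - n) + (n - i))) sums (C * S)" by (intro sums_mult S)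
  have "series \<theta> w x - series \<theta> w y = (\<Sum>i. a i)"
    unfolding series_def a_def using w by (intro suminf_diff summand_summable) auto
  also have "\<bar>\<dots>\<bar> \<le> C * S"
    unfolding sums_unique[OF dom] real_norm_def[symmetric]
    by (rule norm_suminf_le[OF _ sums_summable[OF dom]]) (use a in simp)
  also have "\<dots> \<le> C * (1 + 2 * \<rho> / (1 - \<rho>))" using S C by (intro mult_left_mono)
  also have "\<dots> = \<epsilon> * (6 * M / \<rho> * (1 + 2 * \<rho> / (1 - \<rho>))) * d powr \<sigma>"
    unfolding C_def by (simp only: mult_ac times_divide_eq_left times_divide_eq_right)
  finally show ?thesis by (simp only: d_def \<sigma>_def)
qed (simp add: \<epsilon>0)

lemma series_in_holder_space:
  shows "holder_norm s (series \<theta> []) \<le> ereal (\<epsilon> * (6 * M / \<rho> * (1 + 2 * \<rho> / (1 - \<rho>))))"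
    and "series \<theta> [] \<in> holder_space s"
proof -
  show *: "holder_norm s (series \<theta> []) \<le> ereal (\<epsilon> * (6 * M / \<rho> * (1 + 2 * \<rho> / (1 - \<rho>))))"
    unfolding holder_norm_le_iff k[symmetric]
    using nablaH_series series_holder by (metis order_refl)
  from * have "holder_norm s (series \<theta> []) < \<infinity>" by (rule le_less_trans) simp
  then show "series \<theta> [] \<in> holder_space s"
    unfolding holder_space_def mem_Collect_eq k[symmetric]
    using nablaH_series series_continuous by simp
qed

text \<open>In the coordinates of scale \<open>j\<close> the nodes lie at multiples of
  \<open>\<tau>\<close>, and the bump is 1 at the first and 0 at all others; so scale
  \<open>j\<close> contributes exactly (-1)^(k + 1) \<theta>. The right side bounds the other
  scales.\<close>

lemma series_lattice_coeff:
  assumes \<tau>: "0 < \<tau>" "real (Suc k) * \<tau> \<le> 1/4" and \<phi>1: "\<phi> 0 = 1"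
    and \<phi>0: "\<And>p q r. \<tau> \<le> \<bar>p\<bar> \<Longrightarrow> \<phi> (p, q, r) = 0"
  shows "\<bar>lattice_coeff s N (Suc k) \<tau> j g (series \<theta> []) - (- 1) ^ Suc k * \<theta> j g\<bar>
    \<le> 2 ^ Suc k * (\<epsilon> * M) * (2 * \<rho> / (1 - \<rho>))"
proof -
  define y where "y = hdil (1 / N ^ j) (lat g)"
  define h where "h = \<tau> / N ^ j"
  define m where "m = Suc k"
  have Nj: "N ^ i > 0" for i using N by simp
  have "\<tau> \<le> real (Suc k) * \<tau>" using \<tau> by simp
  then have \<tau>1: "\<tau> \<le> 1" using \<tau> by linarith
  have h: "0 \<le> h" "h \<le> 1 / N ^ j" using Nj[of j] \<tau>(1) \<tau>1 by (auto simp: h_def divide_right_mono)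
  define a where "a i = (N powr s) ^ j * fdelta m h (\<lambda>t. summand \<theta> [] i (hmult y (hexp FX t))) 0" for i
  have sm: "summable (\<lambda>i. summand \<theta> [] i (hmult y (hexp FX t)))" for t by (rule summand_summable) simp
  have "lattice_coeff s N m \<tau> j g (series \<theta> []) = (\<Sum>i. a i)"
    unfolding lattice_coeff_def series_def a_def y_def[symmetric] h_def[symmetric]
    using fdelta_suminf[OF sm] by (simp add: suminf_mult)
  moreover have "a j = (- 1) ^ m * \<theta> j g"
  proof -
    have val: "summand \<theta> [] j (hmult y (hexp FX (real i * h))) = (N powr - s) ^ j * (\<theta> j g * \<phi> (hexp FX (real i * \<tau>)))"
      if i: "i \<le> m" for i
    proof -
      have eq: "hdil (N ^ j) (hmult y (hexp FX (real i * h))) = hmult (lat g) (hexp FX (real i * \<tau>))"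
      proof -
        have "N ^ j * (1 / N ^ j) = 1" "N ^ j * (real i * h) = real i * \<tau>" using N by (simp_all add: h_def)
        then show ?thesis
          by (simp only: y_def hdil_hmult hdil_hdil hdil_hexp hdil_1 fweight.simps power_one_right)
      qed
      have "real i * \<tau> \<le> real m * \<tau>" using i \<tau> by (intro mult_right_mono) auto
      then have "real i * \<tau> \<le> 1/4" using \<tau> unfolding m_def by linarith
      then have "hmult (hinv (lat g)) (hmult (lat g) (hexp FX (real i * \<tau>))) \<in> cube (5/8)"
        unfolding hmult_hinv_cancel using \<tau> by (simp add: in_cube)
      from lift_eq[OF \<phi>(2) this, of "\<theta> j"] show ?thesis
        unfolding summand_def eq nablaH.simps hmult_hinv_cancel by simp
    qed
    have "fdelta m h (\<lambda>t. summand \<theta> [] j (hmult y (hexp FX t))) 0 = (- 1) ^ m * summand \<theta> [] j (hmult y (hexp FX 0))"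
    proof (rule fdelta_single)
      fix i assume i: "1 \<le> i" "i \<le> m"
      then have "\<tau> \<le> \<bar>real i * \<tau>\<bar>" using \<tau> by (simp add: abs_mult)
      then have "\<phi> (hexp FX (real i * \<tau>)) = 0" unfolding hexp.simps by (rule \<phi>0)
      then show "summand \<theta> [] j (hmult y (hexp FX (0 + real i * h))) = 0" using val[OF i(2)] by simp
    qed
    moreover have "summand \<theta> [] j (hmult y (hexp FX 0)) = (N powr - s) ^ j * \<theta> j g"
      using val[of 0] \<phi>1 by simp
    moreover have "(N powr s) ^ j * (N powr - s) ^ j = 1"
      using N by (simp add: powr_add[symmetric] flip: power_mult_distrib)
    ultimately show ?thesis unfolding a_def by simp
  qed
  moreover have "\<bar>(\<Sum>i. a i) - a j\<bar> \<le> 2 ^ m * (\<epsilon> * M) * (2 * \<rho> / (1 - \<rho>))"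
  proof (rule suminf_two_sided_le[OF \<rho>])
    show "2 ^ m * (\<epsilon> * M) \<ge> 0" using \<epsilon>0 M0 by simp
    fix i assume "i \<noteq> j"
    then consider "i > j" | "i < j" by linarith
    then show "\<bar>a i\<bar> \<le> 2 ^ m * (\<epsilon> * M) * \<rho> ^ (i - j + (j - i))"
    proof cases
      \<comment> \<open>Finer scales: the sup bound suffices, as
        \<open>N powr - s \<le> \<rho>\<close>.\<close>
      case 1
      have "\<bar>fdelta m h (\<lambda>t. summand \<theta> [] i (hmult y (hexp FX t))) 0\<bar> \<le> 2 ^ m * ((\<epsilon> * M) * (N powr - s) ^ i)"
        by (rule fdelta_abs_le) (use summand_bound[of "[]" i] in simp)
      then have "\<bar>a i\<bar> \<le> (N powr s) ^ j * (2 ^ m * ((\<epsilon> * M) * (N powr - s) ^ i))"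
        unfolding a_def abs_mult by (simp add: mult_left_mono)
      also have "\<dots> = 2 ^ m * (\<epsilon> * M) * ((N powr s) ^ j * (N powr - s) ^ j * (N powr - s) ^ (i - j))"
        using 1 by (simp add: mult.assoc flip: power_add)
      also have "(N powr s) ^ j * (N powr - s) ^ j = 1"
        using N by (simp add: powr_add[symmetric] flip: power_mult_distrib)
      also have "2 ^ m * (\<epsilon> * M) * (1 * (N powr - s) ^ (i - j)) \<le> 2 ^ m * (\<epsilon> * M) * \<rho> ^ (i - j)"
        using powr_le_\<rho>[of s] frac(3) \<epsilon>0 M0 by (auto intro!: mult_left_mono power_mono)
      finally show ?thesis using 1 by simp
    next
      \<comment> \<open>Coarser scales: k + 1 derivatives of the summand against h^(k + 1). The word
        \<open>replicate 0 FX\<close> is the empty one, written as the start of the chain of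
        derivatives.\<close>
      case 2
      have "\<bar>fdelta m h (\<lambda>t. summand \<theta> (replicate 0 FX) i (hmult y (hexp FX t))) 0\<bar>
          \<le> \<bar>h\<bar> ^ m * ((\<epsilon> * M) * (N powr (real m - s)) ^ i)"
      proof (rule fdelta_deriv_le[where u = "\<lambda>n t. summand \<theta> (replicate n FX) i (hmult y (hexp FX t))"])
        show "((\<lambda>t. summand \<theta> (replicate n FX) i (hmult y (hexp FX t))) has_real_derivative
            summand \<theta> (replicate (Suc n) FX) i (hmult y (hexp FX t))) (at t)" for n t
          using has_fderiv_flow[OF summand_fderiv[of FX "replicate n FX" i], of y t] by simp
        show "\<bar>summand \<theta> (replicate m FX) i (hmult y (hexp FX t))\<bar> \<le> (\<epsilon> * M) * (N powr (real m - s)) ^ i" for t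
          using summand_bound[of "replicate m FX" i] by (simp add: m_def)
      qed
      also have "\<dots> \<le> (1 / N ^ j) ^ m * ((\<epsilon> * M) * (N powr (real m - s)) ^ i)"
        using h \<epsilon>0 M0 by (intro mult_right_mono power_mono) auto
      finally have "\<bar>a i\<bar> \<le> (N powr s) ^ j * ((1 / N ^ j) ^ m * ((\<epsilon> * M) * (N powr (real m - s)) ^ i))"
        unfolding a_def abs_mult by (simp add: mult_left_mono)
      also have "\<dots> = (\<epsilon> * M) * (((N powr s) ^ j * (1 / N ^ j) ^ m) * (N powr (real m - s)) ^ i)" by simp
      also have "(N powr s) ^ j * (1 / N ^ j) ^ m = (N powr (s - real m)) ^ j"
        using N by (simp add: powr_diff powr_realpow power_divide mult.commute flip: power_mult)
      also have "\<dots> = (N powr (s - real m)) ^ (j - i) * (N powr (s - real m)) ^ i"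
        using 2 by (simp flip: power_add)
      also have "\<dots> * (N powr (real m - s)) ^ i = (N powr (s - real m)) ^ (j - i)"
        using N by (simp add: mult.assoc powr_add[symmetric] flip: power_mult_distrib)
      also have "s - real m = - (1 - frac s)" using frac(3) by (simp add: m_def)
      also have "(\<epsilon> * M) * (N powr - (1 - frac s)) ^ (j - i) \<le> (2 ^ m * (\<epsilon> * M)) * \<rho> ^ (j - i)"
      proof (rule mult_mono)
        show "\<epsilon> * M \<le> 2 ^ m * (\<epsilon> * M)"
          using mult_right_mono[of 1 "2 ^ m" "\<epsilon> * M"] \<epsilon>0 M0 by simp
        show "(N powr - (1 - frac s)) ^ (j - i) \<le> \<rho> ^ (j - i)"
          by (intro power_mono powr_le_\<rho>) auto
      qed (use \<epsilon>0 M0 in auto)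
      finally show ?thesis using 2 by simp
    qed
  qed
  ultimately show ?thesis by (simp add: m_def del: power_Suc)
qed

end

end

lemma holder_space_add:
  assumes f: "f \<in> holder_space s" and g: "g \<in> holder_space s"
  shows "(\<lambda>x. f x + g x) \<in> holder_space s"
proof -
  obtain H H' where H: "holder_norm s f \<le> ereal H" "holder_norm s g \<le> ereal H'"
    using holder_space_bound[OF f] holder_space_bound[OF g] by metis
  have add: "nablaH_exists w (\<lambda>x. f x + g x)" "nablaH w (\<lambda>x. f x + g x) = (\<lambda>x. nablaH w f x + nablaH w g x)"
    if "mweight w \<le> nat \<lfloor>s\<rfloor>" for w
    using nablaH_add[OF holder_spaceD(1)[OF f that] holder_spaceD(1)[OF g that]] by auto
  have "holder_norm s (\<lambda>x. f x + g x) \<le> ereal (H + H')"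
    unfolding holder_norm_le_iff
  proof (intro allI impI)
    fix w x y assume w: "mweight w = nat \<lfloor>s\<rfloor>"
    have "\<bar>nablaH w f x - nablaH w f y\<bar> \<le> H * hdist x y powr frac s"
      "\<bar>nablaH w g x - nablaH w g y\<bar> \<le> H' * hdist x y powr frac s"
      using H w unfolding holder_norm_le_iff by blast+
    then show "\<bar>nablaH w (\<lambda>x. f x + g x) x - nablaH w (\<lambda>x. f x + g x) y\<bar> \<le> (H + H') * hdist x y powr frac s"
      using w by (simp add: add distrib_right)
  qed
  then have "holder_norm s (\<lambda>x. f x + g x) < \<infinity>" by (rule le_less_trans) simp
  then show ?thesis
    using holder_spaceD(2)[OF f] holder_spaceD(2)[OF g]
    by (auto simp: holder_space_def add intro!: continuous_on_add)
qed

section \<open>The generic set\<close>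

definition oscillating :: "real \<Rightarrow> real \<Rightarrow> real \<Rightarrow> (heis \<Rightarrow> real) set" where
  "oscillating s N \<tau> = {f \<in> holder_space s. \<exists>c>0. \<forall>j g. c \<le> \<bar>lattice_coeff s N (Suc (nat \<lfloor>s\<rfloor>)) \<tau> j g f\<bar>}"

lemma oscillating_open:
  assumes "s > 0" "N \<ge> 1" "0 \<le> \<tau>" "\<tau> \<le> 1"
  shows "openin (holder_topology s) (oscillating s N \<tau>)"
  unfolding openin_holder_topology holder_open_def
proof (intro conjI ballI)
  show "oscillating s N \<tau> \<subseteq> holder_space s" by (auto simp: oscillating_def)
  fix f assume "f \<in> oscillating s N \<tau>"
  then obtain c where f: "f \<in> holder_space s" and c: "c > 0"
    "\<And>j g. c \<le> \<bar>lattice_coeff s N (Suc (nat \<lfloor>s\<rfloor>)) \<tau> j g f\<bar>"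
    by (auto simp: oscillating_def)
  show "\<exists>e>0. \<forall>g\<in>holder_space s. holder_norm s (\<lambda>x. g x - f x) < ereal e \<longrightarrow> g \<in> oscillating s N \<tau>"
  proof (intro exI conjI ballI impI)
    \<comment> \<open>By \<open>lattice_coeff_le\<close> such a perturbation moves each coefficient
      by at most c/2, which leaves c/2.\<close>
    show "c / 2 > 0" using c by simp
    fix f' assume f': "f' \<in> holder_space s" and less: "holder_norm s (\<lambda>x. f' x - f x) < ereal (c / 2)"
    have ex: "nablaH_exists (replicate (nat \<lfloor>s\<rfloor>) FX) (\<lambda>x. f' x - f x)"
      using f f' by (intro nablaH_diff[THEN conjunct1] holder_spaceD(1)) auto
    have "c / 2 \<le> \<bar>lattice_coeff s N (Suc (nat \<lfloor>s\<rfloor>)) \<tau> j g f'\<bar>" for j g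
    proof -
      have "\<bar>lattice_coeff s N (Suc (nat \<lfloor>s\<rfloor>)) \<tau> j g (\<lambda>x. f' x - f x)\<bar> \<le> c / 2"
        using c(1) assms by (intro lattice_coeff_le[OF ex less_imp_le[OF less]]) auto
      then show ?thesis using c(2)[of j g] unfolding lattice_coeff_diff by linarith
    qed
    then show "f' \<in> oscillating s N \<tau>" using f' \<open>c / 2 > 0\<close> unfolding oscillating_def by blast
  qed
qed

lemma oscillating_exponent:
  assumes f: "f \<in> oscillating s N \<tau>" and s: "s > 0" "s \<notin> \<nat>" and N: "N > 1"
    and \<tau>: "\<tau> \<ge> 0" "real (Suc (nat \<lfloor>s\<rfloor>)) * \<tau> \<le> 1/4"
  shows "pointwise_exponent f x = ereal s"
proof -
  obtain c where c: "c > 0" "\<And>j g. c \<le> \<bar>lattice_coeff s N (Suc (nat \<lfloor>s\<rfloor>)) \<tau> j g f\<bar>"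
    using f by (auto simp: oscillating_def)
  have "s < real (Suc (nat \<lfloor>s\<rfloor>))" using s by linarith
  then have upper: "u \<le> s" if "pointwise_holder u x f" for u
    using lattice_coeff_exponent[OF c N \<tau> s(1) _ that] by blast
  have lower: "pointwise_holder s x f"
    using f s by (intro holder_space_pointwise) (auto simp: oscillating_def)
  have "(SUP u\<in>{u. u > 0 \<and> pointwise_holder u x f}. ereal u) = ereal s"
    using upper lower s(1) by (intro antisym SUP_least SUP_upper) auto
  then show ?thesis using lower s(1) unfolding pointwise_exponent_def by auto
qed

lemma oscillating_dense:
  assumes s: "s > 0" "s \<notin> \<nat>" and \<tau>: "0 < \<tau>" "real (Suc (nat \<lfloor>s\<rfloor>)) * \<tau> \<le> 1/4"
  obtains N where "N > 1" "dense_in_topology (holder_topology s) (oscillating s N \<tau>)"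
proof -
  define k where "k = nat \<lfloor>s\<rfloor>"
  obtain \<phi> where bump: "\<phi> \<in> smooth_alg" "\<phi> 0 = 1" "\<And>p q r. \<tau> \<le> \<bar>p\<bar> \<or> \<tau> \<le> \<bar>q\<bar> \<or> \<tau> \<le> \<bar>r\<bar> \<Longrightarrow> \<phi> (p, q, r) = 0"
    using smooth_bump_exists[OF \<tau>(1)] by blast
  have "\<tau> \<le> real (Suc (nat \<lfloor>s\<rfloor>)) * \<tau>" using \<tau>(1) by simp
  then have \<tau>4: "\<tau> \<le> 1/4" using \<tau>(2) by linarith
  have supp: "{x. \<phi> x \<noteq> 0} \<subseteq> cube (1/4)"
  proof
    fix x assume x: "x \<in> {x. \<phi> x \<noteq> 0}"
    obtain p q r where "x = (p, q, r)" by (cases x)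
    then show "x \<in> cube (1/4)" using x bump(3)[of p q r] \<tau>4 by (force simp: in_cube)
  qed
  have "\<exists>B. \<forall>x. \<bar>nablaH w \<phi> x\<bar> \<le> B" for w
  proof -
    have "compact (nablaH w \<phi> ` cube (1/4))"
      using smooth_alg_nablaH[OF bump(1)] smooth_alg_continuous compact_cube
      by (intro compact_continuous_image) (auto intro: continuous_on_subset)
    from compact_imp_bounded[OF this]
    obtain B where B: "\<And>x. x \<in> cube (1/4) \<Longrightarrow> \<bar>nablaH w \<phi> x\<bar> \<le> B"
      unfolding bounded_iff by auto
    have "nablaH w \<phi> x = 0" if "x \<notin> cube (1/4)" for x
      by (rule nablaH_vanish[OF bump(1) compact_imp_closed[OF compact_cube] _ that]) (use supp in blast)
    then have "\<bar>nablaH w \<phi> x\<bar> \<le> max B 0" for x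
      using B[of x] by (cases "x \<in> cube (1/4)") (simp_all add: le_max_iff_disj)
    then show ?thesis by blast
  qed
  then obtain B where B: "\<And>w x. \<bar>nablaH w \<phi> x\<bar> \<le> B w" by metis
  define M where "M = (\<Sum>w\<in>{w. mweight w \<le> Suc k}. B w)"
  have B0: "B w \<ge> 0" for w using B[of w 0] by linarith
  have M: "\<bar>nablaH w \<phi> x\<bar> \<le> M" if "mweight w \<le> Suc k" for w x
  proof -
    have "B w \<le> M"
      unfolding M_def using that B0 finite_bounded_mweight by (intro member_le_sum) auto
    with B[of w x] show ?thesis by linarith
  qed
  have M0: "M \<ge> 0" using M[of "[]" 0] by simp
  \<comment> \<open>\<open>N\<close> is chosen to give \<open>\<rho> = 1 / (1 + D)\<close>, hence
    \<open>2 * \<rho> / (1 - \<rho>) = 2 / D\<close>. With this \<open>D\<close> the interaction of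
    scales is at most half of the main term, for every \<epsilon>.\<close>
  define \<beta> where "\<beta> = min (frac s) (1 - frac s)"
  define D where "D = 2 ^ (k + 3) * (M + 1)"
  define N where "N = (1 + D) powr (1 / \<beta>)"
  have D: "D > 0" using M0 by (simp add: D_def)
  have "s \<notin> \<int>" using nonneg_not_Nats_imp_not_Ints s by simp
  then have \<beta>: "\<beta> > 0" using frac_lt_1[of s] frac_gt_0_iff[of s] by (auto simp: \<beta>_def)
  have N: "N > 1" unfolding N_def using D \<beta> by (intro gr_one_powr) auto
  interpret bump_series \<phi> s N M k
    by unfold_locales (use bump(1) supp s N M k_def in auto)
  have "N powr - \<beta> = 1 / (1 + D)"
    unfolding N_def using D \<beta> by (simp add: powr_powr powr_minus_divide)
  then have "\<rho> = 1 / (1 + D)" by (simp only: \<rho>_def \<beta>_def)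
  then have "1 - \<rho> = D * \<rho>" using D by (simp add: field_simps)
  then have "2 * \<rho> / (1 - \<rho>) = 2 / D" using \<rho>(1) by simp
  moreover have "2 ^ Suc k * M * (2 / D) \<le> 1 / 2"
  proof -
    have "2 ^ Suc k * M * 2 * 2 \<le> D" unfolding D_def using M0 by (simp add: power_add algebra_simps)
    then show ?thesis using D by (simp add: divide_le_eq mult_ac)
  qed
  ultimately have small: "2 ^ Suc k * M * (2 * \<rho> / (1 - \<rho>)) \<le> 1 / 2" by simp
  define K where "K = 6 * M / \<rho> * (1 + 2 * \<rho> / (1 - \<rho>))"
  have K: "K \<ge> 0" using \<rho> M0 by (simp add: K_def)
  have sub: "oscillating s N \<tau> \<subseteq> holder_space s" by (auto simp: oscillating_def)
  have "f \<in> holder_topology s closure_of oscillating s N \<tau>" if f: "f \<in> holder_space s" for f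
    unfolding in_closure_of topspace_holder_topology openin_holder_topology
  proof (intro conjI allI impI f)
    fix T assume T: "f \<in> T \<and> holder_open s T"
    then obtain e where e: "e > 0"
      "\<And>g. g \<in> holder_space s \<Longrightarrow> holder_norm s (\<lambda>x. g x - f x) < ereal e \<Longrightarrow> g \<in> T"
      unfolding holder_open_def by blast
    \<comment> \<open>The added series has norm at most \<open>\<epsilon> * K\<close>; dividing by
      \<open>K + 1\<close> makes this less than \<open>e\<close> also when
      \<open>K = 0\<close>.\<close>
    define \<epsilon> where "\<epsilon> = e / (K + 1)"
    have \<epsilon>: "\<epsilon> > 0" using e K by (simp add: \<epsilon>_def)
    have \<epsilon>K: "\<epsilon> * K < e" using e K by (simp add: \<epsilon>_def divide_less_eq)
    define L where "L j g = lattice_coeff s N (Suc k) \<tau> j g f" for j g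
    \<comment> \<open>The power of -1 cancels the sign of the difference, and the rest copies the
      sign of the coefficient of \<open>f\<close>. So the main term adds to it in absolute value,
      and at least \<epsilon> - \<epsilon>/2 remains.\<close>
    define \<theta> where "\<theta> j g = (- 1) ^ Suc k * (if L j g \<ge> 0 then \<epsilon> else - \<epsilon>)" for j g
    have \<theta>: "\<bar>\<theta> j g\<bar> \<le> \<epsilon>" for j g using \<epsilon> by (simp add: \<theta>_def abs_mult power_abs)
    let ?G = "series \<theta> []"
    have G: "holder_norm s ?G \<le> ereal (\<epsilon> * K)" "?G \<in> holder_space s"
      using series_in_holder_space[OF \<theta>] by (simp_all add: K_def)
    define f' where "f' = (\<lambda>x. f x + ?G x)"
    have f': "f' \<in> holder_space s" unfolding f'_def by (rule holder_space_add[OF f G(2)])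
    have "holder_norm s (\<lambda>x. f' x - f x) < ereal e"
      using le_less_trans[OF G(1), of "ereal e"] \<epsilon>K by (simp add: f'_def)
    then have "f' \<in> T" by (rule e(2)[OF f'])
    moreover have "\<epsilon> / 2 \<le> \<bar>lattice_coeff s N (Suc k) \<tau> j g f'\<bar>" for j g
    proof -
      have "\<bar>lattice_coeff s N (Suc k) \<tau> j g ?G - (- 1) ^ Suc k * \<theta> j g\<bar>
          \<le> 2 ^ Suc k * (\<epsilon> * M) * (2 * \<rho> / (1 - \<rho>))"
        by (rule series_lattice_coeff[OF \<theta> \<tau>[folded k_def] bump(2)]) (use bump(3) in blast)
      also have "\<dots> = \<epsilon> * (2 ^ Suc k * M * (2 * \<rho> / (1 - \<rho>)))" by simp
      also have "\<dots> \<le> \<epsilon> * (1 / 2)" using \<epsilon> small by (intro mult_left_mono) auto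
      also have "(- 1) ^ Suc k * \<theta> j g = (if L j g \<ge> 0 then \<epsilon> else - \<epsilon>)"
        unfolding \<theta>_def mult.assoc[symmetric] by (simp flip: power_mult_distrib)
      finally have close: "\<bar>lattice_coeff s N (Suc k) \<tau> j g ?G - (if L j g \<ge> 0 then \<epsilon> else - \<epsilon>)\<bar>
        \<le> \<epsilon> * (1 / 2)" .
      have "e / 2 \<le> \<bar>l + t\<bar>" if "\<bar>t - (if l \<ge> 0 then e else - e)\<bar> \<le> e * (1 / 2)" "e > 0" for e l t :: real
        using that by (cases "l \<ge> 0") (simp_all add: abs_if split: if_splits)
      from this[OF close \<epsilon>] show ?thesis
        unfolding f'_def lattice_coeff_add L_def[symmetric] .
    qed
    then have "f' \<in> oscillating s N \<tau>"
      unfolding oscillating_def k_def using f' \<epsilon> by (auto intro!: exI[of _ "\<epsilon> / 2"])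
    ultimately show "\<exists>y. y \<in> oscillating s N \<tau> \<and> y \<in> T" by blast
  qed
  then have "dense_in_topology (holder_topology s) (oscillating s N \<tau>)"
    unfolding dense_in_topology_def topspace_holder_topology
    using sub closure_of_subset_topspace[of "holder_topology s"] by (auto simp: topspace_holder_topology)
  with N show thesis by (rule that)
qed

theorem theorem3:
  fixes s :: real
  assumes "s \<ge> 0" and "s \<notin> \<nat>"
  shows "\<exists>R. R \<subseteq> holder_space s \<and>
             openin (holder_topology s) R \<and>
             dense_in_topology (holder_topology s) R \<and>
             generic_in_topology (holder_topology s) R \<and>
             (\<forall>f\<in>R. \<forall>x. pointwise_exponent f x = ereal s)"
proof -
  have s: "s > 0" using assms by (metis Nats_0 less_eq_real_def)
  \<comment> \<open>The largest step for which all nodes, the last at (k + 1) \<open>\<tau>\<close>,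
    stay within 1/4 of the lattice point.\<close>
  define \<tau> where "\<tau> = 1 / (4 * real (Suc (nat \<lfloor>s\<rfloor>)))"
  have \<tau>: "0 < \<tau>" "real (Suc (nat \<lfloor>s\<rfloor>)) * \<tau> \<le> 1/4" by (simp_all add: \<tau>_def)
  have "\<tau> \<le> real (Suc (nat \<lfloor>s\<rfloor>)) * \<tau>" using \<tau>(1) by simp
  then have \<tau>1: "\<tau> \<le> 1" using \<tau>(2) by linarith
  obtain N where N: "N > 1" and dense: "dense_in_topology (holder_topology s) (oscillating s N \<tau>)"
    using oscillating_dense[OF s assms(2) \<tau>] .
  have sub: "oscillating s N \<tau> \<subseteq> holder_space s" by (auto simp: oscillating_def)
  have op: "openin (holder_topology s) (oscillating s N \<tau>)"
    using s N \<tau> \<tau>1 by (intro oscillating_open) auto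
  moreover have "generic_in_topology (holder_topology s) (oscillating s N \<tau>)"
    unfolding generic_in_topology_def topspace_holder_topology using sub op dense
    \<comment> \<open>A single dense open set, taken as a constant sequence.\<close>
    by (intro conjI exI[of _ "\<lambda>n. oscillating s N \<tau>"]) auto
  moreover have "\<forall>f\<in>oscillating s N \<tau>. \<forall>x. pointwise_exponent f x = ereal s"
    using oscillating_exponent s assms(2) N \<tau> by auto
  ultimately show ?thesis using sub dense by blast
qed

end
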